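(* Suppose that the limits $$f(t,x)=\lim_{\sigma\to0}\rho_\sigma(t,x),\qquad \bar u(t,x)=\lim_{\sigma\to0}\hat u_\sigma(t,x)$$ are $C^1$-smooth bounded functions for $(t,x)\in\Omega:=[0,t_*(u_0))\times\mathbb{R}^n$, $t_*(u_0)\le\infty$. Then $(f,\bar u)$ solves in $\Omega$ the pressureless gas dynamics system $$\partial_tf+\operatorname{div}_x(f\bar u)=0,\qquad \partial_t(f\bar u)+\nabla_x(f\,\bar u\otimes\bar u)=0.$$
   Context: Let $u_0:\mathbb{R}^n\to\mathbb{R}^n$ and $f_0:\mathbb{R}^n\to\mathbb{R}$, $f_0>0$, be of class $C^1(\mathbb{R}^n)\cap C_b(\mathbb{R}^n)$ ($C_b$ = bounded continuous). Here $t_*(u_0)\in(0,+\infty]$ is such that the solution of the Cauchy problem $\partial_tu+(u,\nabla)u=0$, $u(0,x)=u_0(x)$, keeps this smoothness for $0<t<t_*(u_0)$. For $\sigma>0$, $t>0$, $x\in\mathbb{R}^n$, $$\rho_\sigma(t,x)=\frac{1}{(\sqrt{2\pi t}\,\sigma)^n}\int_{\mathbb{R}^n}f_0(s)\,e^{-\frac{|u_0(s)t+s-x|^2}{2\sigma^2t}}\,ds,\qquad \hat u_\sigma(t,x)=\frac{\int_{\mathbb{R}^n}u_0(s)f_0(s)\,e^{-\frac{|u_0(s)t+s-x|^2}{2\sigma^2t}}\,ds}{\int_{\mathbb{R}^n}f_0(s)\,e^{-\frac{|u_0(s)t+s-x|^2}{2\sigma^2t}}\,ds},$$ and $\rho_\sigma(0,x)=f_0(x)$,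 $\hat u_\sigma(0,x)=u_0(x)$. The second equation of the system means $\partial_t(f\bar u_i)+\sum_k\partial_{x_k}(f\bar u_i\bar u_k)=0$ for $i=1,\dots,n$. *)

theory Defs
  imports "HOL-Analysis.Analysis"
begin

definition time_interval :: "ereal \<Rightarrow> real set" where
  "time_interval T = {t. 0 \<le> t \<and> ereal t < T}"

definition Omega :: "ereal \<Rightarrow> (real \<times> (real ^ 'n)) set" where
  "Omega T = time_interval T \<times> UNIV"

text \<open>The derivative is taken within \<open>S\<close>, so on \<open>Omega T\<close> the time derivative at \<open>t = 0\<close> is
  one-sided and smoothness is meant up to and including the initial time.\<close>

definition C1_on :: "'a::euclidean_space set \<Rightarrow> ('a \<Rightarrow> 'b::euclidean_space) \<Rightarrow> bool" where
  "C1_on S g \<longleftrightarrow> (\<exists>D :: 'a \<Rightarrow> 'a \<Rightarrow>\<^sub>L 'b.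
     (\<forall>p\<in>S. (g has_derivative blinfun_apply (D p)) (at p within S)) \<and> continuous_on S D)"

definition C1_bounded_on :: "'a::euclidean_space set \<Rightarrow> ('a \<Rightarrow> 'b::euclidean_space) \<Rightarrow> bool" where
  "C1_bounded_on S g \<longleftrightarrow> C1_on S g \<and> bounded (g ` S)"

definition has_partial_deriv ::
    "(real ^ 'n \<Rightarrow> 'b::real_normed_vector) \<Rightarrow> 'n \<Rightarrow> 'b \<Rightarrow> real ^ 'n \<Rightarrow> bool" where
  "has_partial_deriv g k d x \<longleftrightarrow>
     ((\<lambda>h. g (x + h *\<^sub>R axis k 1)) has_vector_derivative d) (at 0)"

definition has_time_deriv ::
    "ereal \<Rightarrow> (real \<Rightarrow> 'b::real_normed_vector) \<Rightarrow> 'b \<Rightarrow> real \<Rightarrow> bool" where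
  "has_time_deriv T g d t \<longleftrightarrow> (g has_vector_derivative d) (at t within time_interval T)"

definition has_divergence :: "(real ^ 'n \<Rightarrow> real ^ 'n) \<Rightarrow> real \<Rightarrow> real ^ 'n \<Rightarrow> bool" where
  "has_divergence G d x \<longleftrightarrow>
     (\<exists>D. (\<forall>k. has_partial_deriv (\<lambda>y. G y $ k) k (D k) x) \<and> d = (\<Sum>k\<in>UNIV. D k))"

definition smooth_Cauchy_solution ::
    "(real ^ 'n \<Rightarrow> real ^ 'n) \<Rightarrow> ereal \<Rightarrow> (real \<Rightarrow> real ^ 'n \<Rightarrow> real ^ 'n) \<Rightarrow> bool" where
  "smooth_Cauchy_solution u\<^sub>0 T u \<longleftrightarrow>
     C1_on (Omega T) (\<lambda>(t, x). u t x) \<and>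
     (\<forall>t\<in>time_interval T. C1_bounded_on UNIV (u t)) \<and>
     (\<forall>x. u 0 x = u\<^sub>0 x) \<and>
     (\<forall>(t, x)\<in>Omega T. \<exists>ut D.
        has_time_deriv T (\<lambda>\<tau>. u \<tau> x) ut t \<and>
        (\<forall>k. has_partial_deriv (u t) k (D k) x) \<and>
        ut + (\<Sum>k\<in>UNIV. (u t x $ k) *\<^sub>R D k) = 0)"

text \<open>No maximality of the existence time is required: any lifespan of a smooth solution
  qualifies, in particular the maximal one.\<close>

definition smooth_lifespan :: "(real ^ 'n \<Rightarrow> real ^ 'n) \<Rightarrow> ereal \<Rightarrow> bool" where
  "smooth_lifespan u\<^sub>0 T \<longleftrightarrow> 0 < T \<and> (\<exists>u. smooth_Cauchy_solution u\<^sub>0 T u)"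

definition kern :: "(real ^ 'n \<Rightarrow> real ^ 'n) \<Rightarrow> real \<Rightarrow> real \<Rightarrow> real ^ 'n \<Rightarrow> real ^ 'n \<Rightarrow> real" where
  "kern u\<^sub>0 \<sigma> t x s = exp (- ((norm (t *\<^sub>R u\<^sub>0 s + s - x))\<^sup>2 / (2 * \<sigma>\<^sup>2 * t)))"

definition rho ::
    "(real ^ 'n \<Rightarrow> real ^ 'n) \<Rightarrow> (real ^ 'n \<Rightarrow> real) \<Rightarrow> real \<Rightarrow> real \<Rightarrow> real ^ 'n \<Rightarrow> real" where
  "rho u\<^sub>0 f\<^sub>0 \<sigma> t x =
     (if t = 0 then f\<^sub>0 x
      else 1 / (sqrt (2 * pi * t) * \<sigma>) ^ CARD('n) * (LINT s|lborel. f\<^sub>0 s * kern u\<^sub>0 \<sigma> t x s))"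

definition uhat ::
    "(real ^ 'n \<Rightarrow> real ^ 'n) \<Rightarrow> (real ^ 'n \<Rightarrow> real) \<Rightarrow> real \<Rightarrow> real \<Rightarrow> real ^ 'n \<Rightarrow> real ^ 'n" where
  "uhat u\<^sub>0 f\<^sub>0 \<sigma> t x =
     (if t = 0 then u\<^sub>0 x
      else (LINT s|lborel. (f\<^sub>0 s * kern u\<^sub>0 \<sigma> t x s) *\<^sub>R u\<^sub>0 s) /\<^sub>R
           (LINT s|lborel. f\<^sub>0 s * kern u\<^sub>0 \<sigma> t x s))"

definition solves_pressureless_gas ::
    "ereal \<Rightarrow> (real \<Rightarrow> real ^ 'n \<Rightarrow> real) \<Rightarrow> (real \<Rightarrow> real ^ 'n \<Rightarrow> real ^ 'n) \<Rightarrow> bool" where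
  "solves_pressureless_gas T f v \<longleftrightarrow>
     (\<forall>(t, x)\<in>Omega T.
        (\<exists>a d. has_time_deriv T (\<lambda>\<tau>. f \<tau> x) a t \<and>
               has_divergence (\<lambda>y. f t y *\<^sub>R v t y) d x \<and>
               a + d = 0) \<and>
        (\<forall>i. \<exists>a d. has_time_deriv T (\<lambda>\<tau>. f \<tau> x * v \<tau> x $ i) a t \<and>
                    has_divergence (\<lambda>y. (f t y * v t y $ i) *\<^sub>R v t y) d x \<and>
                    a + d = 0))"

end

theory Submission
  imports Defs "HOL-Probability.Distributions"
begin

text \<open>
  Write \<open>\<phi> t s = s + t u\<^sub>0(s)\<close> for the position at time \<open>t\<close> of a free particle started at \<open>s\<close>
  and \<open>J t s = det (I + t Du\<^sub>0(s))\<close> for its Jacobian determinant. Everything rests on the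
  exact formulas \<open>f(t, \<phi> t s) \<bar>J t s\<bar> = f\<^sub>0(s)\<close> and \<open>ubar(t, \<phi> t s) = u\<^sub>0(s)\<close>: the limit system
  is conservation of mass, written once in Lagrangian and once in Eulerian coordinates.

  Let \<open>u\<close> be the smooth solution of \<open>u\<^sub>t + (u, \<nabla>)u = 0\<close> with initial value \<open>u\<^sub>0\<close>. The difference
  \<open>u(t, z + t c) - c\<close> along a straight line satisfies a linear differential equation in \<open>t\<close>, so it
  vanishes at all times once it vanishes at one (\<open>constant_along_line\<close>). Hence
  \<open>u(t, \<phi> t s) = u\<^sub>0(s)\<close>, the map \<open>\<phi> t\<close> is a bijection with the inverse
  \<open>y \<mapsto> y - t u(t, y)\<close>, and \<open>J t s\<close> does not vanish.

  The Gaussian kernel in \<open>\<rho>\<close> and in the averaged velocity, taken at \<open>x = \<phi> t a\<close>, is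
  \<open>exp (- \<bar>\<phi> t s - \<phi> t a\<bar>\<^sup>2 / (2 h\<^sup>2))\<close> with \<open>h = \<sigma> \<surd>t\<close>. After the substitution \<open>s = a + h z\<close> it tends to
  \<open>exp (- \<bar>D\<phi> z\<bar>\<^sup>2 / 2)\<close>, and it is dominated by a fixed Gaussian because \<open>\<phi> t\<close> expands
  distances from \<open>a\<close> by at least a constant factor (\<open>transport_map_expands\<close>). Dominated
  convergence and a linear change of variables give \<open>\<rho> \<rightarrow> m f\<^sub>0(a) / \<bar>J t a\<bar>\<close> with the
  constant \<open>m = 1\<close>, the integral of the standard normal density,
  and the quotient that defines the averaged velocity tends to \<open>u\<^sub>0(a) = u(t, x)\<close>. In particular
  \<open>ubar = u\<close>.

  So \<open>f(t, \<phi> t s)\<^sup>2 (J t s)\<^sup>2\<close> does not depend on \<open>t\<close>. As \<open>D\<phi>\<close> grows by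
  \<open>d/dt D\<phi> = Du D\<phi>\<close>, Jacobi's formula gives \<open>dJ/dt = (div u) J\<close>, and differentiating the
  conserved quantity yields \<open>f\<^sub>t + (u, \<nabla>f) + f div u = 0\<close>, the first equation
  (\<open>continuity_equation\<close>). This is where the smoothness of \<open>f\<close> enters: the formula for \<open>f\<close> involves
  \<open>Du\<close>, which is merely continuous. The second equation is \<open>u\<^sub>i\<close> times the first one plus \<open>f\<close> times
  the equation for \<open>u\<^sub>i\<close>.
\<close>

section \<open>Linear changes of variables\<close>

lemma borel_measurable_linear:
  fixes f :: "'a::euclidean_space \<Rightarrow> 'b::euclidean_space"
  assumes "linear f"
  shows "f \<in> borel_measurable borel"
  using assms by (intro borel_measurable_continuous_onI linear_continuous_on) (simp add: linear_conv_bounded_linear)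

lemma Basis_cart: "Basis = range (\<lambda>i::'n::finite. axis i (1::real))"
  by (auto simp: Basis_vec_def)

lemma inj_axis: "inj (\<lambda>i::'n::finite. axis i (1::real))"
  by (auto simp: inj_on_def axis_eq_axis)

text \<open>
  By Fubini the coordinate \<open>m\<close> can be integrated first, and for fixed other coordinates the shear
  is a translation of that coordinate.
\<close>

lemma nn_integral_shear:
  fixes g :: "real^'n \<Rightarrow> ennreal"
  assumes g [measurable]: "g \<in> borel_measurable borel" and "m \<noteq> n"
  shows "(\<integral>\<^sup>+x. g (\<chi> i. if i = m then x$m + x$n else x$i) \<partial>lborel) = (\<integral>\<^sup>+x. g x \<partial>lborel)"
proof -
  interpret product_sigma_finite "\<lambda>_::real^'n. lborel :: real measure" ..
  define b :: "real^'n" where "b = axis m 1"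
  define c :: "real^'n" where "c = axis n 1"
  define I where "I = Basis - {b}"
  have cI: "c \<in> I" and I: "finite I" "b \<notin> I" "Basis = insert b I"
    using \<open>m \<noteq> n\<close> by (auto simp: b_def c_def I_def axis_eq_axis)
  \<comment> \<open>\<open>E\<close> assembles a vector from its coordinates; \<open>S\<close> is the shear.\<close>
  define E :: "(real^'n \<Rightarrow> real) \<Rightarrow> real^'n" where "E = (\<lambda>w. \<Sum>v\<in>Basis. w v *\<^sub>R v)"
  have E [measurable]: "E \<in> borel_measurable (Pi\<^sub>M Basis (\<lambda>_. lborel))"
    unfolding E_def by measurable
  define S :: "real^'n \<Rightarrow> real^'n" where "S = (\<lambda>x. \<chi> i. if i = m then x$m + x$n else x$i)"
  have "linear S"
    unfolding S_def by (rule linearI) (auto simp: algebra_simps vec_eq_iff)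
  then have S [measurable]: "S \<in> borel_measurable borel"
    by (rule borel_measurable_linear)
  have S_eq: "S x = x + (x \<bullet> c) *\<^sub>R b" for x
  proof -
    have "x \<bullet> c = x $ n"
      by (simp add: c_def inner_axis)
    then show ?thesis
      by (auto simp: S_def b_def vec_eq_iff axis_def)
  qed
  have E_upd: "E (w(b := y)) = (\<Sum>v\<in>I. w v *\<^sub>R v) + y *\<^sub>R b" for w y
    unfolding E_def I(3) using I(1,2) by (auto intro!: sum.cong)
  have E_c: "E (w(b := y)) \<bullet> c = w c" for w y
    using cI I unfolding E_def I_def by (subst inner_sum_left_Basis) auto
  have integral_E: "(\<integral>\<^sup>+x. k x \<partial>lborel)
      = (\<integral>\<^sup>+w. (\<integral>\<^sup>+y. k (E (w(b := y))) \<partial>lborel) \<partial>Pi\<^sub>M I (\<lambda>_. lborel))"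
    if [measurable]: "k \<in> borel_measurable borel" for k :: "real^'n \<Rightarrow> ennreal"
  proof -
    have "(\<integral>\<^sup>+x. k x \<partial>lborel) = (\<integral>\<^sup>+w. k (E w) \<partial>Pi\<^sub>M Basis (\<lambda>_. lborel))"
      by (subst lborel_eq) (simp add: nn_integral_distr E_def[symmetric] cong: measurable_cong_sets)
    also have "\<dots> = (\<integral>\<^sup>+w. (\<integral>\<^sup>+y. k (E (w(b := y))) \<partial>lborel) \<partial>Pi\<^sub>M I (\<lambda>_. lborel))"
      unfolding I(3) by (rule product_nn_integral_insert) (use I in auto)
    finally show ?thesis .
  qed
  have "(\<integral>\<^sup>+y. g (S (E (w(b := y)))) \<partial>lborel) = (\<integral>\<^sup>+y. g (E (w(b := y))) \<partial>lborel)" for w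
  proof -
    have meas: "(\<lambda>y. g (E (w(b := y)))) \<in> borel_measurable borel"
      unfolding E_upd by measurable
    have "S (E (w(b := y))) = E (w(b := w c + 1 * y))" for y
      unfolding S_eq E_c unfolding E_upd by (simp add: algebra_simps)
    then show ?thesis
      using nn_integral_real_affine[OF meas, of 1 "w c"] by simp
  qed
  then have "(\<integral>\<^sup>+x. g (S x) \<partial>lborel) = (\<integral>\<^sup>+x. g x \<partial>lborel)"
    using integral_E[of "\<lambda>x. g (S x)"] integral_E[of g] by simp
  then show ?thesis
    by (simp add: S_def)
qed

lemma nn_integral_permute_coordinates:
  fixes g :: "real^'n \<Rightarrow> ennreal"
  assumes g [measurable]: "g \<in> borel_measurable borel"
  shows "(\<integral>\<^sup>+x. g (\<chi> i. x $ Transposition.transpose m n i) \<partial>lborel) = (\<integral>\<^sup>+x. g x \<partial>lborel)"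
proof -
  define p where "p = Transposition.transpose m n"
  define S :: "real^'n \<Rightarrow> real^'n" where "S = (\<lambda>x. \<chi> i. x $ p i)"
  have p: "p (p i) = i" "bij p" for i
    by (auto simp: p_def)
  have "linear S"
    unfolding S_def by (rule linearI) (auto simp: vec_eq_iff)
  then have S [measurable]: "S \<in> borel_measurable borel"
    by (rule borel_measurable_linear)
  have "lborel = distr lborel borel S"
  proof (rule lborel_eqI)
    fix l u :: "real^'n"
    assume le: "\<And>b. b \<in> Basis \<Longrightarrow> l \<bullet> b \<le> u \<bullet> b"
    have "S -` box l u = box (S l) (S u)"
      unfolding S_def using p(1) by (auto simp: mem_box_cart) metis+
    moreover have "\<forall>b\<in>Basis. S l \<bullet> b \<le> S u \<bullet> b"
    proof -
      have "l $ i \<le> u $ i" for i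
        using le[of "axis i 1"] by (simp add: inner_axis)
      then show ?thesis
        by (auto simp: S_def Basis_vec_def inner_axis)
    qed
    moreover have "(\<Prod>b\<in>Basis. (S u - S l) \<bullet> b) = (\<Prod>b\<in>Basis. (u - l) \<bullet> b)"
    proof -
      have *: "(\<Prod>b\<in>Basis. v \<bullet> b) = (\<Prod>i\<in>UNIV. v $ i)" for v :: "real^'n"
        unfolding Basis_cart by (simp add: prod.reindex[OF inj_axis] inner_axis)
      have "(\<Prod>b\<in>Basis. (S u - S l) \<bullet> b) = (\<Prod>i\<in>UNIV. (S u - S l) $ i)"
        by (rule *)
      also have "\<dots> = (\<Prod>i\<in>UNIV. (u - l) $ p i)"
        by (intro prod.cong) (simp_all add: S_def)
      also have "\<dots> = (\<Prod>i\<in>UNIV. (u - l) $ i)"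
        by (rule prod.reindex_bij_betw[OF p(2)])
      also have "\<dots> = (\<Prod>b\<in>Basis. (u - l) \<bullet> b)"
        by (rule *[symmetric])
      finally show ?thesis .
    qed
    ultimately show "emeasure (distr lborel borel S) (box l u) = (\<Prod>b\<in>Basis. (u - l) \<bullet> b)"
      by (simp add: emeasure_distr emeasure_lborel_box_eq)
  qed simp
  then have "(\<integral>\<^sup>+x. g x \<partial>lborel) = (\<integral>\<^sup>+x. g x \<partial>distr lborel borel S)"
    by (rule arg_cong[where f = "\<lambda>M. integral\<^sup>N M g"])
  also have "\<dots> = (\<integral>\<^sup>+x. g (S x) \<partial>lborel)"
    by (simp add: nn_integral_distr)
  finally show ?thesis
    by (simp add: S_def p_def)
qed

lemma nn_integral_stretch:
  fixes g :: "real^'n \<Rightarrow> ennreal"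
  assumes g [measurable]: "g \<in> borel_measurable borel" and c: "\<And>i. c i \<noteq> 0"
  shows "ennreal \<bar>\<Prod>i\<in>UNIV. c i\<bar> * (\<integral>\<^sup>+x. g (\<chi> i. c i * x$i) \<partial>lborel) = (\<integral>\<^sup>+x. g x \<partial>lborel)"
proof -
  define S :: "real^'n \<Rightarrow> real^'n" where "S = (\<lambda>x. \<chi> i. c i * x$i)"
  have "linear S"
    unfolding S_def by (rule linearI) (auto simp: vec_eq_iff algebra_simps)
  then have S [measurable]: "S \<in> borel_measurable borel"
    by (rule borel_measurable_linear)
  define d :: "real^'n \<Rightarrow> real" where "d b = (\<chi> i. c i) \<bullet> b" for b
  have "0 + (\<Sum>j\<in>Basis. (d j * (x \<bullet> j)) *\<^sub>R j) = S x" for x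
  proof -
    have "(\<Sum>j\<in>Basis. (d j * (x \<bullet> j)) *\<^sub>R j) = (\<Sum>i\<in>UNIV. (c i * x $ i) *\<^sub>R axis i 1)"
      unfolding Basis_cart by (simp add: sum.reindex[OF inj_axis] d_def inner_axis)
    also have "\<dots> = S x"
      by (simp add: S_def vec_eq_iff axis_def if_distrib cong: if_cong)
    finally show ?thesis
      by simp
  qed
  moreover have "d j \<noteq> 0" if "j \<in> Basis" for j
    using that c by (auto simp: Basis_cart d_def inner_axis)
  ultimately have "lborel = density (distr lborel borel S) (\<lambda>_. (\<Prod>j\<in>Basis. \<bar>d j\<bar>))"
    using lborel_affine_euclidean[of d 0] by (simp del: add_0)
  moreover have "(\<Prod>j\<in>Basis. \<bar>d j\<bar>) = \<bar>\<Prod>i\<in>UNIV. c i\<bar>"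
    unfolding Basis_cart by (simp add: prod.reindex[OF inj_axis] d_def inner_axis abs_prod)
  ultimately have "(\<integral>\<^sup>+x. g x \<partial>lborel)
      = (\<integral>\<^sup>+x. g x \<partial>density (distr lborel borel S) (\<lambda>_. ennreal \<bar>\<Prod>i\<in>UNIV. c i\<bar>))"
    by simp
  also have "\<dots> = ennreal \<bar>\<Prod>i\<in>UNIV. c i\<bar> * (\<integral>\<^sup>+x. g (S x) \<partial>lborel)"
    by (simp add: nn_integral_density nn_integral_distr nn_integral_cmult)
  finally show ?thesis
    by (simp add: S_def)
qed

lemma abs_det_swap: "\<bar>det (matrix (\<lambda>x::real^'n. \<chi> i. x $ Transposition.transpose m n i))\<bar> = 1"
proof -
  let ?h = "\<lambda>x::real^'n. \<chi> i. x $ Transposition.transpose m n i"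
  have "linear ?h"
    by (rule linearI) (auto simp: vec_eq_iff)
  moreover have "?h \<circ> ?h = id"
    by (auto simp: vec_eq_iff)
  ultimately have "det (matrix ?h) * det (matrix ?h) = 1"
    using matrix_compose[of ?h ?h] by (metis det_mul matrix_id)
  then show ?thesis
    by (simp add: power2_eq_square flip: abs_square_eq_1)
qed

lemma det_shear:
  assumes "m \<noteq> n"
  shows "det (matrix (\<lambda>x::real^'n. \<chi> i. if i = m then x$m + x$n else x$i)) = 1"
proof -
  have "matrix (\<lambda>x::real^'n. \<chi> i. if i = m then x$m + x$n else x$i)
      = (\<chi> k. if k = m then row m (mat 1) + 1 *s row n (mat 1) else row k (mat 1))"
    using assms by (auto simp: matrix_def row_def mat_def axis_def vec_eq_iff)
  then show ?thesis
    using det_row_operation[OF assms, of "mat 1 :: real^'n^'n" 1] by simp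
qed

text \<open>
  Both sides are multiplicative in \<open>A\<close>, so elementary linear maps suffice: a map with a vanishing
  row is excluded by the determinant, and the diagonal maps, transpositions and shears are treated
  above.
\<close>

lemma nn_integral_linear_substitution:
  fixes A :: "real^'n \<Rightarrow> real^'n"
  assumes "linear A" and "det (matrix A) \<noteq> 0" and "g \<in> borel_measurable borel"
  shows "ennreal \<bar>det (matrix A)\<bar> * (\<integral>\<^sup>+x. g (A x) \<partial>lborel) = (\<integral>\<^sup>+x. g x \<partial>lborel)"
proof -
  have "\<forall>g\<in>borel_measurable borel. det (matrix A) \<noteq> 0 \<longrightarrow>
      ennreal \<bar>det (matrix A)\<bar> * (\<integral>\<^sup>+x. g (A x) \<partial>lborel) = (\<integral>\<^sup>+x. g x \<partial>lborel)"
    using \<open>linear A\<close>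
  proof (induction A rule: induct_linear_elementary
      [consumes 1, case_names comp zeroes const swap idplus])
    case (comp f h)
    have [measurable]: "f \<in> borel_measurable borel" "h \<in> borel_measurable borel"
      using comp.hyps by (auto intro: borel_measurable_linear)
    have det: "det (matrix (f \<circ> h)) = det (matrix f) * det (matrix h)"
      using comp.hyps by (simp add: matrix_compose det_mul)
    show ?case
    proof (intro ballI impI)
      fix g :: "real^'n \<Rightarrow> ennreal"
      assume g [measurable]: "g \<in> borel_measurable borel" and "det (matrix (f \<circ> h)) \<noteq> 0"
      then have nz: "det (matrix f) \<noteq> 0" "det (matrix h) \<noteq> 0"
        by (auto simp: det)
      have "ennreal \<bar>det (matrix (f \<circ> h))\<bar> * (\<integral>\<^sup>+x. g ((f \<circ> h) x) \<partial>lborel)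
          = ennreal \<bar>det (matrix f)\<bar> * (ennreal \<bar>det (matrix h)\<bar> * (\<integral>\<^sup>+x. g (f (h x)) \<partial>lborel))"
        by (simp add: det abs_mult ennreal_mult mult.assoc)
      also have "\<dots> = ennreal \<bar>det (matrix f)\<bar> * (\<integral>\<^sup>+x. g (f x) \<partial>lborel)"
        using comp(4)[rule_format, of "\<lambda>x. g (f x)"] nz by simp
      also have "\<dots> = (\<integral>\<^sup>+x. g x \<partial>lborel)"
        using comp(3) nz by simp
      finally show "ennreal \<bar>det (matrix (f \<circ> h))\<bar> * (\<integral>\<^sup>+x. g ((f \<circ> h) x) \<partial>lborel) = (\<integral>\<^sup>+x. g x \<partial>lborel)" .
    qed
  next
    case (zeroes f i)
    then have "row i (matrix f) = 0"
      by (auto simp: row_def matrix_def vec_eq_iff)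
    then have "det (matrix f) = 0"
      by (rule det_zero_row)
    then show ?case
      by simp
  next
    case (const c)
    have "matrix (\<lambda>x::real^'n. \<chi> i. c i * x$i) = (\<chi> i j. if i = j then c i else 0)"
      by (auto simp: matrix_def axis_def vec_eq_iff)
    then have "det (matrix (\<lambda>x::real^'n. \<chi> i. c i * x$i)) = (\<Prod>i\<in>UNIV. c i)"
      by (simp add: det_diagonal)
    then show ?case
      using nn_integral_stretch[of _ c] by simp
  next
    case (swap m n)
    then show ?case
      by (simp add: abs_det_swap nn_integral_permute_coordinates)
  next
    case (idplus m n)
    then show ?case
      by (simp add: det_shear nn_integral_shear)
  qed
  then show ?thesis
    using assms by blast
qed

section \<open>Concentration of Gaussian averages\<close>

text \<open>
  The integrand factors into one-dimensional normal densities over the coordinates.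
\<close>

lemma integrable_gaussian:
  assumes "c > 0"
  shows "integrable lborel (\<lambda>z::'a::euclidean_space. exp (- ((norm (c *\<^sub>R z))\<^sup>2 / 2)))"
proof (rule integrableI_bounded)
  have "(\<lambda>x. exp (- ((c * x)\<^sup>2 / 2))) = (\<lambda>x. sqrt (2 * pi * (1 / c)\<^sup>2) * normal_density 0 (1 / c) x)"
    using assms by (auto simp: normal_density_def fun_eq_iff field_simps)
  then have int1: "integrable lborel (\<lambda>x::real. exp (- ((c * x)\<^sup>2 / 2)))"
    using assms by (simp add: integrable_normal_density)
  have "(\<integral>\<^sup>+z. ennreal (norm (exp (- ((norm (c *\<^sub>R z))\<^sup>2 / 2)))) \<partial>(lborel :: 'a measure))
      = (\<integral>\<^sup>+z. (\<Prod>b\<in>Basis. ennreal (exp (- ((c * (z \<bullet> b))\<^sup>2 / 2)))) \<partial>(lborel :: 'a measure))"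
  proof (rule nn_integral_cong)
    fix z :: 'a
    have "(norm (c *\<^sub>R z))\<^sup>2 = (\<Sum>b\<in>Basis. (c * (z \<bullet> b))\<^sup>2)"
      unfolding power2_norm_eq_inner by (subst euclidean_inner) (simp add: power2_eq_square)
    then have "exp (- ((norm (c *\<^sub>R z))\<^sup>2 / 2)) = (\<Prod>b\<in>Basis. exp (- ((c * (z \<bullet> b))\<^sup>2 / 2)))"
      by (simp add: sum_divide_distrib flip: exp_sum sum_negf)
    then show "ennreal (norm (exp (- ((norm (c *\<^sub>R z))\<^sup>2 / 2))))
        = (\<Prod>b\<in>Basis. ennreal (exp (- ((c * (z \<bullet> b))\<^sup>2 / 2))))"
      by (simp add: prod_ennreal prod_nonneg)
  qed
  also have "\<dots> = (\<Prod>b\<in>(Basis :: 'a set). \<integral>\<^sup>+x. ennreal (exp (- ((c * x)\<^sup>2 / 2))) \<partial>lborel)"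
    by (rule nn_integral_lborel_prod) auto
  also have "\<dots> < \<infinity>"
    using int1 by (simp add: nn_integral_eq_integral prod_ennreal ennreal_power)
  finally show "(\<integral>\<^sup>+z. ennreal (norm (exp (- ((norm (c *\<^sub>R z))\<^sup>2 / 2)))) \<partial>(lborel :: 'a measure)) < \<infinity>" .
qed simp

lemma gaussian_integral_pos:
  "0 < (LINT z|lborel. exp (- ((norm (z::'a::euclidean_space))\<^sup>2 / 2)))"
proof -
  let ?G = "\<lambda>z::'a. exp (- ((norm z)\<^sup>2 / 2))"
  have int: "integrable lborel ?G"
    using integrable_gaussian[of 1] by simp
  have "(LINT z|lborel. ?G z) \<noteq> 0"
  proof
    assume "(LINT z|lborel. ?G z) = 0"
    then have "AE z::'a in lborel. False"
      using integral_nonneg_eq_0_iff_AE[OF int] by simp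
    then have "emeasure lborel (UNIV :: 'a set) = 0"
      using AE_iff_measurable[of UNIV "lborel :: 'a measure" "\<lambda>_. False"] by simp
    then show False
      by simp
  qed
  moreover have "(LINT z|lborel. ?G z) \<ge> 0"
    by (rule integral_nonneg_AE) simp
  ultimately show ?thesis
    by linarith
qed

lemma tendsto_difference_quotient:
  assumes "(phi has_derivative A) (at a)"
  shows "((\<lambda>h::real. (phi (a + h *\<^sub>R z) - phi a) /\<^sub>R h) \<longlongrightarrow> A z) (at 0)"
proof -
  have A: "linear A"
    using assms has_derivative_linear by blast
  have "((\<lambda>h::real. phi (a + h *\<^sub>R z)) has_derivative (\<lambda>h. A (h *\<^sub>R z))) (at 0)"
    by (rule has_derivative_compose[of "\<lambda>h. a + h *\<^sub>R z" "\<lambda>h. h *\<^sub>R z" 0 UNIV phi A])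
      (auto intro!: derivative_eq_intros assms)
  then have lim: "((\<lambda>h. norm (phi (a + h *\<^sub>R z) - phi a - A (h *\<^sub>R z)) / norm h) \<longlongrightarrow> 0) (at 0)"
    by (simp add: has_derivative_at)
  have "norm (phi (a + h *\<^sub>R z) - phi a - A (h *\<^sub>R z)) / norm h
      = norm ((phi (a + h *\<^sub>R z) - phi a) /\<^sub>R h - A z)" if "h \<noteq> 0" for h :: real
  proof -
    have "(phi (a + h *\<^sub>R z) - phi a) /\<^sub>R h - A z = (phi (a + h *\<^sub>R z) - phi a - A (h *\<^sub>R z)) /\<^sub>R h"
      using that by (simp add: linear_scale[OF A] scaleR_diff_right)
    then show ?thesis
      by (simp add: divide_inverse mult.commute)
  qed
  then have "((\<lambda>h. norm ((phi (a + h *\<^sub>R z) - phi a) /\<^sub>R h - A z)) \<longlongrightarrow> 0) (at 0)"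
    by (intro Lim_transform_eventually[OF lim]) (auto simp: eventually_at_filter)
  then show ?thesis
    using LIM_zero_iff tendsto_norm_zero_iff by blast
qed

text \<open>
  Laplace's method at a point where the exponent has a nondegenerate global minimum. After the
  substitution \<open>s = a + h z\<close> the integrand converges pointwise, because the difference quotient of
  \<open>phi\<close> tends to \<open>A z\<close>; the linear lower bound on the growth of \<open>phi\<close> away from \<open>a\<close> provides the
  Gaussian majorant that does not depend on \<open>h\<close>.
\<close>

lemma gaussian_concentration:
  fixes phi :: "'a::euclidean_space \<Rightarrow> 'a" and g :: "'a \<Rightarrow> 'b::euclidean_space"
  assumes deriv: "(phi has_derivative A) (at a)"
    and cont: "continuous_on UNIV phi" "continuous_on UNIV g"
    and c: "c > 0" "\<And>s. c * norm (s - a) \<le> norm (phi s - phi a)"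
    and M: "\<And>s. norm (g s) \<le> M"
  shows "((\<lambda>h. (LINT s|lborel. exp (- ((norm (phi s - phi a))\<^sup>2 / (2 * h\<^sup>2))) *\<^sub>R g s) /\<^sub>R h ^ DIM('a))
    \<longlongrightarrow> (LINT z|lborel. exp (- ((norm (A z))\<^sup>2 / 2))) *\<^sub>R g a) (at_right 0)"
proof -
  have [measurable]: "phi \<in> borel_measurable borel" "g \<in> borel_measurable borel"
    using cont by (auto intro: borel_measurable_continuous_onI)
  have "linear A"
    using deriv has_derivative_linear by blast
  then have [measurable]: "A \<in> borel_measurable borel"
    by (intro borel_measurable_continuous_onI linear_continuous_on) (simp add: linear_conv_bounded_linear)
  have expansion: "c * norm z \<le> norm ((phi (a + h *\<^sub>R z) - phi a) /\<^sub>R h)" if h: "h > 0" for h z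
  proof -
    have "(c * norm z) * h \<le> norm (phi (a + h *\<^sub>R z) - phi a)"
      using c(2)[of "a + h *\<^sub>R z"] h by (simp add: mult_ac)
    then have "c * norm z \<le> norm (phi (a + h *\<^sub>R z) - phi a) / h"
      using h by (simp add: pos_le_divide_eq)
    then show ?thesis
      using h by (simp add: divide_inverse_commute)
  qed
  define q where "q h z = exp (- ((norm ((phi (a + h *\<^sub>R z) - phi a) /\<^sub>R h))\<^sup>2 / 2)) *\<^sub>R g (a + h *\<^sub>R z)"
    for h :: real and z
  have rescale: "(LINT s|lborel. exp (- ((norm (phi s - phi a))\<^sup>2 / (2 * h\<^sup>2))) *\<^sub>R g s) /\<^sub>R h ^ DIM('a)
      = (LINT z|lborel. q h z)" if h: "h > 0" for h
  proof -
    define k where "k s = exp (- ((norm (phi s - phi a))\<^sup>2 / (2 * h\<^sup>2))) *\<^sub>R g s" for s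
    have [measurable]: "k \<in> borel_measurable borel"
      unfolding k_def by measurable
    have "integral\<^sup>L lborel k
        = integral\<^sup>L (density (distr lborel borel (\<lambda>z. a + h *\<^sub>R z)) (\<lambda>_. \<bar>h\<bar> ^ DIM('a))) k"
      using lborel_affine[of h a] h by (intro arg_cong[where f = "\<lambda>N. integral\<^sup>L N k"]) (simp add: ennreal_power)
    also have "\<dots> = (LINT z|lborel. h ^ DIM('a) *\<^sub>R k (a + h *\<^sub>R z))"
      using h by (subst integral_density) (auto simp: integral_distr)
    also have "\<dots> = h ^ DIM('a) *\<^sub>R (LINT z|lborel. q h z)"
    proof -
      have "(norm (v /\<^sub>R h))\<^sup>2 / 2 = (norm v)\<^sup>2 / (2 * h\<^sup>2)" for v :: 'a
        using h by (simp add: power_mult_distrib field_simps)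
      then have "k (a + h *\<^sub>R z) = q h z" for z
        by (simp only: q_def k_def)
      then show ?thesis
        by (simp only: integral_scaleR_right)
    qed
    finally have "integral\<^sup>L lborel k /\<^sub>R h ^ DIM('a) = integral\<^sup>L lborel (q h)"
      using h by simp
    then show ?thesis
      unfolding k_def .
  qed
  have "((\<lambda>h. LINT z|lborel. q h z) \<longlongrightarrow> (LINT z|lborel. exp (- ((norm (A z))\<^sup>2 / 2)) *\<^sub>R g a)) (at_right 0)"
  proof (rule tendsto_at_right_sequentially[of 0 1])
    fix S :: "nat \<Rightarrow> real"
    assume S: "\<And>n. 0 < S n" "S \<longlonglongrightarrow> 0"
    then have S0: "filterlim S (at 0) sequentially"
      by (auto simp: filterlim_at less_imp_neq intro!: always_eventually less_imp_neq[symmetric])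
    show "(\<lambda>n. LINT z|lborel. q (S n) z) \<longlonglongrightarrow> (LINT z|lborel. exp (- ((norm (A z))\<^sup>2 / 2)) *\<^sub>R g a)"
    proof (rule integral_dominated_convergence[where w = "\<lambda>z. exp (- ((norm (c *\<^sub>R z))\<^sup>2 / 2)) * M"])
      show "integrable lborel (\<lambda>z::'a. exp (- ((norm (c *\<^sub>R z))\<^sup>2 / 2)) * M)"
        using integrable_gaussian[OF c(1)] by (rule integrable_mult_left)
      have "(\<lambda>n. q (S n) z) \<longlonglongrightarrow> exp (- ((norm (A z))\<^sup>2 / 2)) *\<^sub>R g a" for z
      proof -
        have "(\<lambda>n. (phi (a + S n *\<^sub>R z) - phi a) /\<^sub>R S n) \<longlonglongrightarrow> A z"
          by (rule filterlim_compose[OF tendsto_difference_quotient[OF deriv] S0])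
        moreover have "(\<lambda>n. a + S n *\<^sub>R z) \<longlonglongrightarrow> a + 0 *\<^sub>R z"
          by (intro tendsto_intros S)
        then have "(\<lambda>n. g (a + S n *\<^sub>R z)) \<longlonglongrightarrow> g a"
          using continuous_on_tendsto_compose[OF cont(2)] by simp
        ultimately show ?thesis
          unfolding q_def by (intro tendsto_intros) auto
      qed
      then show "AE z in lborel. (\<lambda>n. q (S n) z) \<longlonglongrightarrow> exp (- ((norm (A z))\<^sup>2 / 2)) *\<^sub>R g a"
        by simp
      have "norm (q (S n) z) \<le> exp (- ((norm (c *\<^sub>R z))\<^sup>2 / 2)) * M" for n z
      proof -
        have "norm (c *\<^sub>R z) \<le> norm ((phi (a + S n *\<^sub>R z) - phi a) /\<^sub>R S n)"
            using expansion[OF S(1)] c(1) by simp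
        then have "(norm (c *\<^sub>R z))\<^sup>2 \<le> (norm ((phi (a + S n *\<^sub>R z) - phi a) /\<^sub>R S n))\<^sup>2"
          by (rule power_mono) simp
        then show ?thesis
          using M[of "a + S n *\<^sub>R z"] by (auto simp: q_def intro!: mult_mono)
      qed
      then show "AE z in lborel. norm (q (S n) z) \<le> exp (- ((norm (c *\<^sub>R z))\<^sup>2 / 2)) * M" for n
        by simp
    qed (simp_all add: q_def)
  qed simp
  \<comment> \<open>The lower bound on the difference quotients passes to the limit, so \<open>A\<close> satisfies it too.\<close>
  moreover have "integrable lborel (\<lambda>z. exp (- ((norm (A z))\<^sup>2 / 2)))"
  proof (rule Bochner_Integration.integrable_bound[OF integrable_gaussian[OF c(1)]])
    have "norm (c *\<^sub>R z) \<le> norm (A z)" for z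
    proof (rule tendsto_lowerbound)
      show "((\<lambda>h::real. norm ((phi (a + h *\<^sub>R z) - phi a) /\<^sub>R h)) \<longlongrightarrow> norm (A z)) (at_right 0)"
        by (intro tendsto_norm tendsto_within_subset[OF tendsto_difference_quotient[OF deriv]]) simp
      show "\<forall>\<^sub>F h in at_right 0. norm (c *\<^sub>R z) \<le> norm ((phi (a + h *\<^sub>R z) - phi a) /\<^sub>R h)"
        using expansion c(1) by (auto simp: eventually_at_filter)
    qed simp
    then show "AE z in lborel. norm (exp (- ((norm (A z))\<^sup>2 / 2))) \<le> norm (exp (- ((norm (c *\<^sub>R z))\<^sup>2 / 2)))"
      by (auto intro!: AE_I2 power_mono simp del: norm_scaleR)
  qed simp
  then have "(LINT z|lborel. exp (- ((norm (A z))\<^sup>2 / 2)) *\<^sub>R g a)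
      = (LINT z|lborel. exp (- ((norm (A z))\<^sup>2 / 2))) *\<^sub>R g a"
    by (rule integral_scaleR_left)
  ultimately have "((\<lambda>h. LINT z|lborel. q h z) \<longlongrightarrow> (LINT z|lborel. exp (- ((norm (A z))\<^sup>2 / 2))) *\<^sub>R g a) (at_right 0)"
    by metis
  then show ?thesis
    by (rule Lim_transform_eventually) (auto simp: eventually_at_filter rescale)
qed

text \<open>
  Near \<open>x\<close> the derivative controls the increment of \<open>psi\<close>; away from \<open>x\<close> the increment differs
  from \<open>y - x\<close> by at most \<open>2 M\<close>, which is a multiple of \<open>norm (y - x)\<close> there.
\<close>

lemma lipschitz_at_point_of_bounded_displacement:
  fixes psi :: "'a::real_normed_vector \<Rightarrow> 'a"
  assumes deriv: "(psi has_derivative P) (at x)" and M: "\<And>y. norm (psi y - y) \<le> M"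
  obtains C where "C > 0" "\<And>y. norm (psi y - psi x) \<le> C * norm (y - x)"
proof -
  obtain K where K: "K > 0" "\<And>v. norm (P v) \<le> norm v * K"
    using has_derivative_bounded_linear[OF deriv] bounded_linear.pos_bounded by blast
  obtain d where d: "d > 0" "\<And>y. norm (y - x) < d \<Longrightarrow> norm (psi y - psi x - P (y - x)) \<le> 1 * norm (y - x)"
    using deriv unfolding has_derivative_at_alt by (meson zero_less_one)
  have "M \<ge> 0"
    using M[of x] norm_ge_zero order_trans by blast
  show ?thesis
  proof
    show "(1 + K) + (1 + 2 * M / d) > 0"
      using K \<open>M \<ge> 0\<close> d by (simp add: add_pos_nonneg)
    fix y
    show "norm (psi y - psi x) \<le> ((1 + K) + (1 + 2 * M / d)) * norm (y - x)"
    proof (cases "norm (y - x) < d")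
      case True
      have "norm (psi y - psi x) \<le> norm (psi y - psi x - P (y - x)) + norm (P (y - x))"
        by (metis diff_add_cancel norm_triangle_ineq)
      also have "\<dots> \<le> (1 + K) * norm (y - x)"
        using d(2)[OF True] K(2)[of "y - x"] by (simp add: algebra_simps)
      also have "\<dots> \<le> ((1 + K) + (1 + 2 * M / d)) * norm (y - x)"
        using \<open>M \<ge> 0\<close> d(1) by (intro mult_right_mono) auto
      finally show ?thesis .
    next
      case False
      have "norm ((psi y - y) - (psi x - x) + (y - x)) \<le> norm (psi y - y) + norm (psi x - x) + norm (y - x)"
        using norm_triangle_ineq[of "(psi y - y) - (psi x - x)" "y - x"]
          norm_triangle_ineq4[of "psi y - y" "psi x - x"] by linarith
      also have "(psi y - y) - (psi x - x) + (y - x) = psi y - psi x"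
        by simp
      finally have "norm (psi y - psi x) \<le> norm (psi y - y) + norm (psi x - x) + norm (y - x)" .
      also have "\<dots> \<le> 2 * M + norm (y - x)"
        using M[of y] M[of x] by simp
      also have "2 * M \<le> 2 * M / d * norm (y - x)"
        using False d(1) \<open>M \<ge> 0\<close> by (simp add: field_simps mult_left_mono)
      also have "2 * M / d * norm (y - x) + norm (y - x) \<le> ((1 + K) + (1 + 2 * M / d)) * norm (y - x)"
        using K(1) by (simp add: algebra_simps)
      finally show ?thesis
        by simp
    qed
  qed
qed

lemma gaussian_integral_matrix:
  fixes B :: "real^'n^'n"
  assumes "det B \<noteq> 0"
  shows "(LINT z|lborel. exp (- ((norm (B *v z))\<^sup>2 / 2)))
    = (LINT z|lborel. exp (- ((norm (z :: real^'n))\<^sup>2 / 2))) / \<bar>det B\<bar>"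
proof -
  have [measurable]: "(*v) B \<in> borel_measurable borel"
    by (rule borel_measurable_linear) simp
  have "ennreal \<bar>det B\<bar> * (\<integral>\<^sup>+z. ennreal (exp (- ((norm (B *v z))\<^sup>2 / 2))) \<partial>lborel)
      = (\<integral>\<^sup>+z. ennreal (exp (- ((norm (z :: real^'n))\<^sup>2 / 2))) \<partial>lborel)"
    using nn_integral_linear_substitution[of "(*v) B" "\<lambda>z. ennreal (exp (- ((norm z)\<^sup>2 / 2)))"] assms
    by (simp add: matrix_of_matrix_vector_mul)
  then have "\<bar>det B\<bar> * (LINT z|lborel. exp (- ((norm (B *v z))\<^sup>2 / 2)))
      = (LINT z|lborel. exp (- ((norm (z :: real^'n))\<^sup>2 / 2)))"
    by (simp add: integral_eq_nn_integral enn2real_mult flip: \<open>_ = (\<integral>\<^sup>+z. _ \<partial>_)\<close>)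
  then show ?thesis
    using assms by (simp add: field_simps)
qed

section \<open>Derivatives of determinants\<close>

text \<open>
  In the Leibniz formula only the identity permutation contributes to first order: every other
  permutation moves at least two points, so its product has at least two factors that vanish
  at \<open>h = 0\<close>.
\<close>

lemma has_derivative_det_at_identity:
  fixes C :: "real^'n^'n"
  shows "((\<lambda>h. det (mat 1 + h *\<^sub>R C)) has_real_derivative trace C) (at 0)"
proof -
  define P where "P p = (\<Sum>i\<in>UNIV. C $ i $ p i * (\<Prod>j\<in>UNIV - {i}. mat 1 $ j $ p j))" for p :: "'n \<Rightarrow> 'n"
  have P: "P p = (if p = id then trace C else 0)" if p: "p permutes UNIV" for p
  proof (cases "p = id")
    case True
    then show ?thesis
      by (simp add: P_def trace_def mat_def)
  next
    case False
    \<comment> \<open>A permutation that fixes every point but one fixes that point as well.\<close>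
    have "\<exists>j\<in>UNIV - {i}. p j \<noteq> j" for i
    proof (rule ccontr)
      assume "\<not> ?thesis"
      then have fixed: "p j = j" if "j \<noteq> i" for j
        using that by auto
      moreover have "p i = i"
        using fixed[of "p i"] permutes_inj[OF p] by (metis injD)
      ultimately show False
        using False by (metis eq_id_iff)
    qed
    then have vanish: "(\<Prod>j\<in>UNIV - {i}. mat 1 $ j $ p j) = (0::real)" for i
      by (intro prod_zero) (auto simp: mat_def, metis)
    then show ?thesis
      using False by (simp only: P_def vanish mult_zero_right sum.neutral_const if_False)
  qed
  have "((\<lambda>h. \<Prod>i\<in>UNIV. (mat 1 + h *\<^sub>R C) $ i $ p i) has_real_derivative P p) (at 0)" for p
  proof -
    have "((\<lambda>h. \<Prod>i\<in>UNIV. (mat 1 + h *\<^sub>R C) $ i $ p i) has_derivative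
        (\<lambda>y. \<Sum>i\<in>UNIV. (y * C $ i $ p i) * (\<Prod>j\<in>UNIV - {i}. (mat 1 + 0 *\<^sub>R C) $ j $ p j))) (at 0)"
      by (rule has_derivative_prod) (auto intro!: derivative_eq_intros)
    moreover have "(\<lambda>y. \<Sum>i\<in>UNIV. (y * C $ i $ p i) * (\<Prod>j\<in>UNIV - {i}. (mat 1 + 0 *\<^sub>R C) $ j $ p j)) = (*) (P p)"
      by (auto simp: fun_eq_iff P_def sum_distrib_left sum_distrib_right mult_ac)
    ultimately show ?thesis
      by (simp only: has_field_derivative_def)
  qed
  then have "((\<lambda>h. det (mat 1 + h *\<^sub>R C)) has_real_derivative
      (\<Sum>p | p permutes UNIV. of_int (sign p) * P p)) (at 0)"
    unfolding det_def by (intro DERIV_sum DERIV_cmult)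
  also have "(\<Sum>p | p permutes UNIV. of_int (sign p) * P p)
      = (\<Sum>p | p permutes (UNIV::'n set). if p = id then trace C else 0)"
    by (intro sum.cong) (auto simp: P)
  also have "\<dots> = trace C"
    by (simp add: finite_permutations permutes_id)
  finally show ?thesis .
qed

text \<open>
  Jacobi's formula for \<open>M t = I + t B\<close>. The hypothesis says \<open>M' = C M\<close>; as \<open>M\<close> is affine in \<open>t\<close>, it
  gives the exact factorization \<open>M \<tau> = (I + (\<tau> - t) C) M t\<close>, which moves the differentiation to
  the identity matrix.
\<close>

lemma has_derivative_det_affine:
  fixes B C :: "real^'n^'n"
  assumes "C ** (mat 1 + t *\<^sub>R B) = B"
  shows "((\<lambda>t. det (mat 1 + t *\<^sub>R B)) has_real_derivative trace C * det (mat 1 + t *\<^sub>R B)) (at t)"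
proof -
  let ?M = "\<lambda>t. mat 1 + t *\<^sub>R B"
  have factor: "?M \<tau> = (mat 1 + (\<tau> - t) *\<^sub>R C) ** ?M t" for \<tau>
  proof -
    have matrix_mul_add_right: "(X + Y) ** Z = X ** Z + Y ** Z" for X Y Z :: "real^'n^'n"
      by (simp add: matrix_matrix_mult_def vec_eq_iff distrib_right sum.distrib)
    have "(mat 1 + (\<tau> - t) *\<^sub>R C) ** ?M t = ?M t + (\<tau> - t) *\<^sub>R (C ** ?M t)"
      by (simp add: matrix_mul_add_right flip: scalar_matrix_assoc)
    also have "\<dots> = ?M \<tau>"
      unfolding assms by (simp add: algebra_simps)
    finally show ?thesis ..
  qed
  have "((\<lambda>\<tau>. det (mat 1 + (\<tau> - t) *\<^sub>R C)) has_real_derivative trace C) (at t)"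
    using DERIV_shift[of "\<lambda>h. det (mat 1 + h *\<^sub>R C)" "trace C" t "- t"] has_derivative_det_at_identity[of C]
    by simp
  then have "((\<lambda>\<tau>. det (mat 1 + (\<tau> - t) *\<^sub>R C) * det (?M t)) has_real_derivative trace C * det (?M t)) (at t)"
    by (rule DERIV_cmult_right)
  then show ?thesis
    by (subst factor) (simp add: det_mul)
qed

section \<open>Uniqueness for linear differential inequalities\<close>

lemma power2_norm_exp_weight_derivative:
  fixes w :: "real \<Rightarrow> 'a::euclidean_space"
  assumes "(w has_vector_derivative w') (at t within S)"
  shows "((\<lambda>t. exp (k * t) * (norm (w t))\<^sup>2) has_derivative
      (\<lambda>h. h * (exp (k * t) * (k * (norm (w t))\<^sup>2 + 2 * (w t \<bullet> w'))))) (at t within S)"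
proof -
  have w: "(w has_derivative (\<lambda>h. h *\<^sub>R w')) (at t within S)"
    using assms by (simp add: has_vector_derivative_def)
  have "((\<lambda>t. exp (k * t)) has_derivative (\<lambda>h. exp (k * t) * (k * h))) (at t within S)"
    by (auto intro!: derivative_eq_intros)
  from has_derivative_mult[OF this has_derivative_inner[OF w w]] show ?thesis
    unfolding power2_norm_eq_inner
    by (rule has_derivative_eq_rhs) (simp add: fun_eq_iff algebra_simps inner_commute)
qed

text \<open>
  Gronwall's argument in both time directions: \<open>exp (- 2 K t) \<bar>w t\<bar>\<^sup>2\<close> is nonincreasing and
  \<open>exp (2 K t) \<bar>w t\<bar>\<^sup>2\<close> is nondecreasing, so a zero of \<open>w\<close> spreads forward by the first and backward
  by the second. The derivatives are taken within the interval so that the lemma reaches the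
  initial time.
\<close>

lemma zero_of_linear_growth:
  fixes w :: "real \<Rightarrow> 'a::euclidean_space"
  assumes deriv: "\<And>t. t \<in> {a..b} \<Longrightarrow> (w has_vector_derivative w' t) (at t within {a..b})"
    and bound: "\<And>t. t \<in> {a..b} \<Longrightarrow> norm (w' t) \<le> K * norm (w t)"
    and s: "s \<in> {a..b}" "w s = 0" and t: "t \<in> {a..b}"
  shows "w t = 0"
proof -
  define E where "E k t = exp (k * t) * (norm (w t))\<^sup>2" for k t
  define E' where "E' k t = exp (k * t) * (k * (norm (w t))\<^sup>2 + 2 * (w t \<bullet> w' t))" for k t
  have E: "(E k has_derivative (\<lambda>h. h * E' k t)) (at t within {p..q})"
    if "t \<in> {p..q}" "{p..q} \<subseteq> {a..b}" for k t p q
    unfolding E_def[abs_def] E'_def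
    by (rule power2_norm_exp_weight_derivative, rule has_vector_derivative_within_subset[OF deriv]) (use that in auto)
  have inner: "\<bar>2 * (w t \<bullet> w' t)\<bar> \<le> 2 * K * (norm (w t))\<^sup>2" if "t \<in> {a..b}" for t
  proof -
    have "\<bar>w t \<bullet> w' t\<bar> \<le> norm (w t) * norm (w' t)"
      by (rule Cauchy_Schwarz_ineq2)
    also have "\<dots> \<le> norm (w t) * (K * norm (w t))"
      using bound[OF that] by (rule mult_left_mono) simp
    finally show ?thesis
      by (simp add: power2_eq_square mult_ac)
  qed
  have "E (if s \<le> t then - (2 * K) else 2 * K) t \<le> 0"
  proof (cases "s \<le> t")
    case True
    obtain r where r: "r \<in> {s..t}" "E (- (2 * K)) t - E (- (2 * K)) s = (t - s) * E' (- (2 * K)) r"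
      using mvt_very_simple[OF True, of "E (- (2 * K))" "\<lambda>r h. h * E' (- (2 * K)) r"] E[of _ s t] s t by auto
    have "E' (- (2 * K)) r \<le> 0"
      unfolding E'_def using inner[of r] r s t by (intro mult_nonneg_nonpos) auto
    then have "(t - s) * E' (- (2 * K)) r \<le> 0"
      using True by (intro mult_nonneg_nonpos) auto
    with r have "E (- (2 * K)) t \<le> E (- (2 * K)) s"
      by linarith
    then show ?thesis
      using True s(2) by (simp add: E_def)
  next
    case False
    obtain r where r: "r \<in> {t..s}" "E (2 * K) s - E (2 * K) t = (s - t) * E' (2 * K) r"
      using mvt_very_simple[of t s "E (2 * K)" "\<lambda>r h. h * E' (2 * K) r"] False E[of _ t s] s t by auto
    have "E' (2 * K) r \<ge> 0"
      unfolding E'_def using inner[of r] r s t by (intro mult_nonneg_nonneg) auto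
    then have "(s - t) * E' (2 * K) r \<ge> 0"
      using False by (intro mult_nonneg_nonneg) auto
    with r have "E (2 * K) t \<le> E (2 * K) s"
      by linarith
    then show ?thesis
      using False s(2) by (simp add: E_def)
  qed
  then show ?thesis
    by (simp add: E_def mult_le_0_iff split: if_splits)
qed

section \<open>Derivatives in space and time\<close>

lemma Icc_subset_time_interval: "t \<in> time_interval T \<Longrightarrow> {0..t} \<subseteq> time_interval T"
proof
  fix r assume "t \<in> time_interval T" "r \<in> {0..t}"
  then show "r \<in> time_interval T"
    using le_less_trans[of "ereal r" "ereal t" T] by (simp add: time_interval_def)
qed

text \<open>
  Every time has later times in its neighbourhood, the initial one included, so derivatives within
  the time interval are unique.
\<close>

lemma at_within_time_interval:
  assumes "t \<in> time_interval T"
  shows "at t within time_interval T \<noteq> bot"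
proof -
  obtain b where b: "t < b" "ereal b < T"
    using assms ereal_dense2[of "ereal t" T] by (auto simp: time_interval_def)
  have "b \<in> time_interval T"
    using assms b by (auto simp: time_interval_def)
  moreover have "{t..b} \<subseteq> {0..b}"
    using assms by (auto simp: time_interval_def)
  ultimately have "{t..b} \<subseteq> time_interval T"
    using Icc_subset_time_interval by blast
  then have "at t within {t..b} \<le> at t within time_interval T"
    by (rule at_le)
  then show ?thesis
    using at_within_Icc_at_right[OF b(1)] trivial_limit_at_right_real[of t] bot.extremum_uniqueI by metis
qed

lemma derivative_along_line:
  fixes g :: "real \<Rightarrow> real^'n \<Rightarrow> 'c::real_normed_vector"
  assumes g: "((\<lambda>(t, x). g t x) has_derivative G) (at (t, z + t *\<^sub>R c) within Omega T)"
    and t: "t \<in> time_interval T"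
  shows "((\<lambda>\<tau>. g \<tau> (z + \<tau> *\<^sub>R c)) has_vector_derivative G (1, c)) (at t within time_interval T)"
proof -
  have path: "((\<lambda>\<tau>. (\<tau>, z + \<tau> *\<^sub>R c)) has_derivative (\<lambda>h. (h, h *\<^sub>R c))) (at t within time_interval T)"
    by (auto intro!: derivative_eq_intros)
  have "((\<lambda>(t, x). g t x) has_derivative G) (at (t, z + t *\<^sub>R c) within (\<lambda>\<tau>. (\<tau>, z + \<tau> *\<^sub>R c)) ` time_interval T)"
    by (rule has_derivative_subset[OF g]) (auto simp: Omega_def)
  from has_derivative_in_compose[OF path this]
  have "((\<lambda>\<tau>. g \<tau> (z + \<tau> *\<^sub>R c)) has_derivative (\<lambda>h. G (h, h *\<^sub>R c))) (at t within time_interval T)"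
    by simp
  moreover have "G (h, h *\<^sub>R c) = h *\<^sub>R G (1, c)" for h
    using linear_scale[OF has_derivative_linear[OF g], of h "(1, c)"] by simp
  ultimately show ?thesis
    by (simp add: has_vector_derivative_def)
qed

lemma spatial_derivative:
  fixes g :: "real \<Rightarrow> real^'n \<Rightarrow> 'c::real_normed_vector"
  assumes g: "((\<lambda>(t, x). g t x) has_derivative G) (at (t, x) within Omega T)"
    and t: "t \<in> time_interval T"
  shows "(g t has_derivative (\<lambda>v. G (0, v))) (at x)"
proof -
  have slice: "((\<lambda>y. (t, y)) has_derivative (\<lambda>v. (0, v))) (at x)"
    by (auto intro!: derivative_eq_intros)
  have "((\<lambda>(t, x). g t x) has_derivative G) (at (t, x) within range (\<lambda>y. (t, y)))"
    by (rule has_derivative_subset[OF g]) (use t in \<open>auto simp: Omega_def\<close>)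
  from has_derivative_in_compose[OF slice this] show ?thesis
    by simp
qed

lemma linear_axis_expansion:
  fixes A :: "real^'n \<Rightarrow> 'b::real_vector"
  assumes "linear A"
  shows "A v = (\<Sum>k\<in>UNIV. (v $ k) *\<^sub>R A (axis k 1))"
proof -
  have "v = (\<Sum>k\<in>UNIV. (v $ k) *\<^sub>R axis k 1)"
    by (simp add: vec_eq_iff axis_def if_distrib cong: if_cong)
  then have "A v = A (\<Sum>k\<in>UNIV. (v $ k) *\<^sub>R axis k 1)"
    by (rule arg_cong)
  then show ?thesis
    by (simp add: linear_sum[OF assms] linear_scale[OF assms])
qed

lemma has_partial_deriv_of_has_derivative:
  assumes "(g has_derivative G) (at x)"
  shows "has_partial_deriv g k (G (axis k 1)) x"
proof -
  have "((\<lambda>h::real. g (x + h *\<^sub>R axis k 1)) has_derivative (\<lambda>h. G (h *\<^sub>R axis k 1))) (at 0)"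
    by (rule has_derivative_compose[of "\<lambda>h. x + h *\<^sub>R axis k 1" "\<lambda>h. h *\<^sub>R axis k 1" 0 UNIV g G])
      (auto intro!: derivative_eq_intros assms)
  then show ?thesis
    using linear_scale[OF has_derivative_linear[OF assms]]
    by (simp add: has_partial_deriv_def has_vector_derivative_def)
qed

lemma has_divergence_scaleR:
  fixes a :: "real^'n \<Rightarrow> real" and v :: "real^'n \<Rightarrow> real^'n"
  assumes a: "(a has_derivative A) (at x)" and v: "(v has_derivative V) (at x)"
  shows "has_divergence (\<lambda>y. a y *\<^sub>R v y) (A (v x) + a x * (\<Sum>k\<in>UNIV. V (axis k 1) $ k)) x"
  unfolding has_divergence_def
proof (intro exI conjI allI)
  fix k
  have "((\<lambda>y. v y $ k) has_derivative (\<lambda>w. V w $ k)) (at x)"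
    using bounded_linear.has_derivative[OF bounded_linear_vec_nth v] .
  from has_derivative_mult[OF a this]
  have "((\<lambda>y. (a y *\<^sub>R v y) $ k) has_derivative (\<lambda>w. a x * V w $ k + A w * v x $ k)) (at x)"
    by simp
  from has_partial_deriv_of_has_derivative[OF this, of k]
  show "has_partial_deriv (\<lambda>y. (a y *\<^sub>R v y) $ k) k (a x * V (axis k 1) $ k + A (axis k 1) * v x $ k) x" .
next
  show "A (v x) + a x * (\<Sum>k\<in>UNIV. V (axis k 1) $ k)
      = (\<Sum>k\<in>UNIV. a x * V (axis k 1) $ k + A (axis k 1) * v x $ k)"
    by (subst linear_axis_expansion[OF has_derivative_linear[OF a]])
      (simp add: sum.distrib sum_distrib_left mult_ac)
qed

section \<open>Particle trajectories of the Burgers equation\<close>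

definition transport_map :: "('a::real_vector \<Rightarrow> 'a) \<Rightarrow> real \<Rightarrow> 'a \<Rightarrow> 'a" where
  "transport_map v t s = s + t *\<^sub>R v s"

text \<open>
  The equation is stated through the total derivative: \<open>(1, u t x)\<close> is the direction in which a
  particle at \<open>x\<close> moves through space-time.
\<close>

locale burgers_flow =
  fixes T :: ereal and u :: "real \<Rightarrow> real^'n \<Rightarrow> real^'n"
    and D :: "real \<times> (real^'n) \<Rightarrow> (real \<times> (real^'n)) \<Rightarrow>\<^sub>L (real^'n)"
  assumes T_pos: "0 < T"
    and deriv: "\<And>t x. t \<in> time_interval T \<Longrightarrow>
      ((\<lambda>(t, x). u t x) has_derivative blinfun_apply (D (t, x))) (at (t, x) within Omega T)"
    and D_cont: "continuous_on (Omega T) D"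
    and bounded: "\<And>t. t \<in> time_interval T \<Longrightarrow> bounded (range (u t))"
    and burgers: "\<And>t x. t \<in> time_interval T \<Longrightarrow> blinfun_apply (D (t, x)) (1, u t x) = 0"
begin

lemma time_zero: "0 \<in> time_interval T"
  using T_pos by (simp add: time_interval_def zero_ereal_def)

text \<open>
  For \<open>w \<tau> = u \<tau> (z + \<tau> c) - c\<close> the equation gives
  \<open>w' = D(1, c) = D(1, u) - D(0, w) = - D(0, w)\<close>, a linear equation for \<open>w\<close>; by compactness its
  coefficient is bounded on the time interval between \<open>0\<close> and the larger of \<open>s\<close> and \<open>t\<close>. Taking the
  known time \<open>s\<close> to be \<open>0\<close> shows that particles keep their velocity; taking the other time to be
  \<open>0\<close> traces a particle back to its origin.
\<close>

lemma constant_along_line: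
  assumes s: "s \<in> time_interval T" "u s (z + s *\<^sub>R c) = c" and t: "t \<in> time_interval T"
  shows "u t (z + t *\<^sub>R c) = c"
proof -
  define b where "b = max s t"
  have b: "b \<in> time_interval T" "s \<in> {0..b}" "t \<in> {0..b}"
    using s t by (auto simp: b_def max_def time_interval_def)
  have sub: "{0..b} \<subseteq> time_interval T"
    using b by (simp add: Icc_subset_time_interval)
  define p where "p \<tau> = (\<tau>, z + \<tau> *\<^sub>R c)" for \<tau>
  have p: "p \<tau> \<in> Omega T" if "\<tau> \<in> {0..b}" for \<tau>
    using that sub by (auto simp: p_def Omega_def)
  have "continuous_on {0..b} (\<lambda>\<tau>. D (p \<tau>))"
    using p by (intro continuous_on_compose2[OF D_cont]) (auto simp: p_def intro!: continuous_intros)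
  then have "bounded ((\<lambda>\<tau>. D (p \<tau>)) ` {0..b})"
    by (intro compact_imp_bounded compact_continuous_image compact_Icc)
  then obtain K where K: "\<And>\<tau>. \<tau> \<in> {0..b} \<Longrightarrow> norm (D (p \<tau>)) \<le> K"
    unfolding bounded_iff by blast
  define w where "w \<tau> = u \<tau> (z + \<tau> *\<^sub>R c) - c" for \<tau>
  have w: "(w has_vector_derivative - blinfun_apply (D (p \<tau>)) (0, w \<tau>)) (at \<tau> within {0..b})"
    if \<tau>: "\<tau> \<in> {0..b}" for \<tau>
  proof -
    have I: "\<tau> \<in> time_interval T"
      using \<tau> sub by auto
    have "((\<lambda>\<tau>. u \<tau> (z + \<tau> *\<^sub>R c)) has_vector_derivative blinfun_apply (D (p \<tau>)) (1, c)) (at \<tau> within {0..b})"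
      unfolding p_def
      by (rule has_vector_derivative_within_subset[OF derivative_along_line[OF deriv[OF I] I] sub])
    moreover have "blinfun_apply (D (p \<tau>)) (1, c) = - blinfun_apply (D (p \<tau>)) (0, w \<tau>)"
    proof -
      have "(1::real, c) = (1, u \<tau> (z + \<tau> *\<^sub>R c)) - (0, w \<tau>)"
        by (simp add: w_def)
      then have "blinfun_apply (D (p \<tau>)) (1, c)
          = blinfun_apply (D (p \<tau>)) (1, u \<tau> (z + \<tau> *\<^sub>R c)) - blinfun_apply (D (p \<tau>)) (0, w \<tau>)"
        by (simp only: blinfun.diff_right)
      then show ?thesis
        using burgers[OF I, of "z + \<tau> *\<^sub>R c"] by (simp add: p_def)
    qed
    ultimately show ?thesis
      unfolding w_def by (auto intro!: derivative_eq_intros)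
  qed
  have "norm (- blinfun_apply (D (p \<tau>)) (0, w \<tau>)) \<le> K * norm (w \<tau>)" if "\<tau> \<in> {0..b}" for \<tau>
    using norm_blinfun[of "D (p \<tau>)" "(0, w \<tau>)"] mult_right_mono[OF K[OF that], of "norm (w \<tau>)"]
    by (simp add: norm_Pair)
  from zero_of_linear_growth[OF w this, of s t] have "w t = 0"
    using b s by (simp add: w_def)
  then show ?thesis
    by (simp add: w_def)
qed

lemma velocity_at_transport_map:
  assumes "t \<in> time_interval T"
  shows "u t (transport_map (u 0) t s) = u 0 s"
  unfolding transport_map_def
  using constant_along_line[of 0 s "u 0 s" t] time_zero assms by simp

lemma transport_map_inverse:
  assumes "t \<in> time_interval T"
  shows "transport_map (u 0) t (y - t *\<^sub>R u t y) = y"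
proof -
  have "u 0 (y - t *\<^sub>R u t y) = u t y"
    using constant_along_line[of t "y - t *\<^sub>R u t y" "u t y" 0] time_zero assms by simp
  then show ?thesis
    by (simp add: transport_map_def)
qed

definition velocity_gradient :: "real \<Rightarrow> real^'n \<Rightarrow> real^'n^'n" where
  "velocity_gradient t x = matrix (\<lambda>v. blinfun_apply (D (t, x)) (0, v))"

lemma velocity_gradient_mult: "velocity_gradient t x *v v = blinfun_apply (D (t, x)) (0, v)"
proof -
  have "linear (\<lambda>v. blinfun_apply (D (t, x)) (0, v))"
    by (rule linearI) (simp_all flip: blinfun.add_right blinfun.scaleR_right)
  then show ?thesis
    unfolding velocity_gradient_def by (simp add: matrix_works)
qed

lemma has_derivative_velocity:
  "t \<in> time_interval T \<Longrightarrow> (u t has_derivative (\<lambda>v. velocity_gradient t x *v v)) (at x)"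
  unfolding velocity_gradient_mult by (rule spatial_derivative[OF deriv])

lemma continuous_velocity: "t \<in> time_interval T \<Longrightarrow> continuous_on UNIV (u t)"
  using has_derivative_velocity by (meson has_derivative_continuous_on has_derivative_at_withinI)

abbreviation transport_gradient :: "real \<Rightarrow> real^'n \<Rightarrow> real^'n^'n" where
  "transport_gradient t s \<equiv> mat 1 + t *\<^sub>R velocity_gradient 0 s"

lemma has_derivative_transport_map:
  "(transport_map (u 0) t has_derivative (\<lambda>v. transport_gradient t s *v v)) (at s)"
proof -
  have "((\<lambda>s. s + t *\<^sub>R u 0 s) has_derivative (\<lambda>v. v + t *\<^sub>R (velocity_gradient 0 s *v v))) (at s)"
    by (intro has_derivative_add has_derivative_ident has_derivative_scaleR_right
        has_derivative_velocity time_zero)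
  then show ?thesis
    by (simp add: transport_map_def[abs_def] matrix_vector_mult_add_rdistrib scaleR_matrix_vector_assoc)
qed

text \<open>
  Differentiate \<open>u t (\<phi> t s) = u 0 s\<close> in \<open>s\<close>.
\<close>

lemma velocity_gradient_transport:
  assumes t: "t \<in> time_interval T"
  shows "velocity_gradient t (transport_map (u 0) t s) ** transport_gradient t s = velocity_gradient 0 s"
proof -
  have "((\<lambda>s. u t (transport_map (u 0) t s)) has_derivative
      (\<lambda>v. velocity_gradient t (transport_map (u 0) t s) *v (transport_gradient t s *v v))) (at s)"
    by (rule has_derivative_compose[OF has_derivative_transport_map has_derivative_velocity[OF t]])
  then have "(u 0 has_derivative
      (\<lambda>v. velocity_gradient t (transport_map (u 0) t s) *v (transport_gradient t s *v v))) (at s)"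
    by (simp add: velocity_at_transport_map[OF t])
  then have "(\<lambda>v. velocity_gradient t (transport_map (u 0) t s) *v (transport_gradient t s *v v))
      = (\<lambda>v. velocity_gradient 0 s *v v)"
    using has_derivative_unique has_derivative_velocity[OF time_zero] by blast
  then show ?thesis
    by (simp add: matrix_eq matrix_vector_mul_assoc[symmetric] fun_eq_iff)
qed

text \<open>
  The inverse matrix is \<open>I - t Du\<close>, the derivative of the inverse map \<open>y \<mapsto> y - t u t y\<close>.
\<close>

lemma det_transport_gradient_nonzero:
  assumes t: "t \<in> time_interval T"
  shows "det (transport_gradient t s) \<noteq> 0"
proof -
  let ?C = "velocity_gradient t (transport_map (u 0) t s)"
  have "(mat 1 - t *\<^sub>R ?C) ** transport_gradient t s = transport_gradient t s - t *\<^sub>R (?C ** transport_gradient t s)"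
    by (simp add: matrix_eq algebra_simps matrix_vector_mul_assoc[symmetric] scaleR_matrix_vector_assoc[symmetric])
  also have "\<dots> = mat 1"
    by (simp add: velocity_gradient_transport[OF t])
  finally show ?thesis
    by (metis det_I det_mul mult_zero_right zero_neq_one)
qed

text \<open>
  Equivalently, the inverse map \<open>y \<mapsto> y - t u t y\<close> does not stretch distances from the point
  \<open>\<phi> t a\<close> by more than a constant factor. It is differentiable and, as \<open>u t\<close> is bounded, displaces
  points by a bounded amount.
\<close>

lemma transport_map_expands:
  assumes t: "t \<in> time_interval T"
  obtains c where "c > 0"
    "\<And>s. c * norm (s - a) \<le> norm (transport_map (u 0) t s - transport_map (u 0) t a)"
proof -
  define psi where "psi y = y - t *\<^sub>R u t y" for y
  have psi: "psi (transport_map (u 0) t s) = s" for s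
    by (simp add: psi_def velocity_at_transport_map[OF t]) (simp add: transport_map_def)
  obtain M where M: "\<And>y. norm (u t y) \<le> M"
    using bounded[OF t] unfolding bounded_iff by blast
  have bound: "norm (psi y - y) \<le> \<bar>t\<bar> * M" for y
    using M[of y] by (simp add: psi_def mult_left_mono)
  have "(psi has_derivative (\<lambda>v. v - t *\<^sub>R (velocity_gradient t y *v v))) (at y)" for y
    unfolding psi_def
    by (intro has_derivative_diff has_derivative_ident has_derivative_scaleR_right has_derivative_velocity t)
  then obtain C where C: "C > 0"
    "\<And>y. norm (psi y - psi (transport_map (u 0) t a)) \<le> C * norm (y - transport_map (u 0) t a)"
    using lipschitz_at_point_of_bounded_displacement[OF _ bound] by blast
  show ?thesis
  proof
    show "1 / C > 0"
      using C(1) by simp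
    show "1 / C * norm (s - a) \<le> norm (transport_map (u 0) t s - transport_map (u 0) t a)" for s
      using C(2)[of "transport_map (u 0) t s"] C(1) by (simp add: psi field_simps)
  qed
qed

section \<open>Limits of the regularized density and velocity\<close>

text \<open>
  The kernel at \<open>x = \<phi> t a\<close> has width \<open>h = \<sigma> \<surd>t\<close>, and \<open>g\<close> is the particle density for \<open>rho\<close> and the
  momentum density for the numerator of \<open>uhat\<close>.
\<close>

lemma gaussian_average_limit:
  fixes g :: "real^'n \<Rightarrow> 'b::euclidean_space"
  assumes t: "t \<in> time_interval T" "t > 0"
    and g: "continuous_on UNIV g" "\<And>s. norm (g s) \<le> M"
  shows "((\<lambda>\<sigma>. (LINT s|lborel. kern (u 0) \<sigma> t (transport_map (u 0) t a) s *\<^sub>R g s)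
      /\<^sub>R (\<sigma> * sqrt t) ^ CARD('n))
    \<longlongrightarrow> ((LINT z|lborel. exp (- ((norm (z :: real^'n))\<^sup>2 / 2))) / \<bar>det (transport_gradient t a)\<bar>) *\<^sub>R g a)
    (at_right 0)"
proof -
  let ?phi = "transport_map (u 0) t"
  obtain c where c: "c > 0" "\<And>s. c * norm (s - a) \<le> norm (?phi s - ?phi a)"
    using transport_map_expands[OF t(1)] by blast
  have cont: "continuous_on UNIV ?phi"
    unfolding transport_map_def by (intro continuous_intros continuous_velocity time_zero)
  have "((\<lambda>h. (LINT s|lborel. exp (- ((norm (?phi s - ?phi a))\<^sup>2 / (2 * h\<^sup>2))) *\<^sub>R g s) /\<^sub>R h ^ CARD('n))
      \<longlongrightarrow> ((LINT z|lborel. exp (- ((norm (z :: real^'n))\<^sup>2 / 2))) / \<bar>det (transport_gradient t a)\<bar>) *\<^sub>R g a)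
      (at_right 0)"
    using gaussian_concentration[OF has_derivative_transport_map cont g(1) c g(2)]
      gaussian_integral_matrix[OF det_transport_gradient_nonzero[OF t(1)], of a] by simp
  moreover have "filterlim (\<lambda>\<sigma>. \<sigma> * sqrt t) (at_right 0) (at_right 0)"
    unfolding filterlim_at
  proof
    show "\<forall>\<^sub>F \<sigma> in at_right 0. \<sigma> * sqrt t \<in> {0<..} \<and> \<sigma> * sqrt t \<noteq> 0"
      using t(2) by (auto simp: eventually_at_filter)
    have "((\<lambda>\<sigma>. \<sigma> * sqrt t) \<longlongrightarrow> 0 * sqrt t) (at_right 0)"
      by (intro tendsto_intros)
    then show "((\<lambda>\<sigma>. \<sigma> * sqrt t) \<longlongrightarrow> 0) (at_right 0)"
      by simp
  qed
  ultimately have lim: "((\<lambda>\<sigma>. (LINT s|lborel. exp (- ((norm (?phi s - ?phi a))\<^sup>2 / (2 * (\<sigma> * sqrt t)\<^sup>2))) *\<^sub>R g s)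
        /\<^sub>R (\<sigma> * sqrt t) ^ CARD('n))
      \<longlongrightarrow> ((LINT z|lborel. exp (- ((norm (z :: real^'n))\<^sup>2 / 2))) / \<bar>det (transport_gradient t a)\<bar>) *\<^sub>R g a)
      (at_right 0)"
    by (rule filterlim_compose)
  have "kern (u 0) \<sigma> t (?phi a) s = exp (- ((norm (?phi s - ?phi a))\<^sup>2 / (2 * (\<sigma> * sqrt t)\<^sup>2)))" for \<sigma> s
    using t(2) by (simp add: kern_def power_mult_distrib transport_map_def[of _ _ s] add.commute mult.assoc)
  then show ?thesis
    using lim by simp
qed

lemma rho_limit:
  fixes f\<^sub>0 :: "real^'n \<Rightarrow> real"
  assumes t: "t \<in> time_interval T" "t > 0"
    and f\<^sub>0: "continuous_on UNIV f\<^sub>0" "\<And>s. norm (f\<^sub>0 s) \<le> M"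
  shows "((\<lambda>\<sigma>. rho (u 0) f\<^sub>0 \<sigma> t (transport_map (u 0) t a))
    \<longlongrightarrow> (LINT z|lborel. exp (- ((norm (z :: real^'n))\<^sup>2 / 2))) / sqrt (2 * pi) ^ CARD('n)
        * (f\<^sub>0 a / \<bar>det (transport_gradient t a)\<bar>)) (at_right 0)"
proof -
  let ?x = "transport_map (u 0) t a"
  have "rho (u 0) f\<^sub>0 \<sigma> t ?x
      = ((LINT s|lborel. kern (u 0) \<sigma> t ?x s *\<^sub>R f\<^sub>0 s) /\<^sub>R (\<sigma> * sqrt t) ^ CARD('n)) / sqrt (2 * pi) ^ CARD('n)"
    for \<sigma>
    using t(2) by (simp add: rho_def real_sqrt_mult power_mult_distrib divide_inverse mult_ac)
  then show ?thesis
    using tendsto_divide[OF gaussian_average_limit[OF t f\<^sub>0, of a] tendsto_const[of "sqrt (2 * pi) ^ CARD('n)"]]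
    by (simp add: mult_ac)
qed

lemma uhat_limit:
  fixes f\<^sub>0 :: "real^'n \<Rightarrow> real"
  assumes t: "t \<in> time_interval T" "t > 0"
    and f\<^sub>0: "continuous_on UNIV f\<^sub>0" "\<And>s. norm (f\<^sub>0 s) \<le> M" "f\<^sub>0 a \<noteq> 0"
  shows "((\<lambda>\<sigma>. uhat (u 0) f\<^sub>0 \<sigma> t (transport_map (u 0) t a)) \<longlongrightarrow> u 0 a) (at_right 0)"
proof -
  let ?x = "transport_map (u 0) t a"
  define L where "L = (LINT z|lborel. exp (- ((norm (z :: real^'n))\<^sup>2 / 2))) / \<bar>det (transport_gradient t a)\<bar>"
  have "L > 0"
    unfolding L_def
    by (intro divide_pos_pos gaussian_integral_pos) (simp add: det_transport_gradient_nonzero[OF t(1)])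
  then have L: "L \<noteq> 0"
    by simp
  obtain N where N: "\<And>y. norm (u 0 y) \<le> N"
    using bounded[OF time_zero] unfolding bounded_iff by blast
  define num where "num \<sigma> = (LINT s|lborel. kern (u 0) \<sigma> t ?x s *\<^sub>R (f\<^sub>0 s *\<^sub>R u 0 s))" for \<sigma>
  define den where "den \<sigma> = (LINT s|lborel. kern (u 0) \<sigma> t ?x s *\<^sub>R f\<^sub>0 s)" for \<sigma>
  have "norm (f\<^sub>0 s *\<^sub>R u 0 s) \<le> M * N" for s
    using f\<^sub>0(2)[of s] N[of s] by (auto intro!: mult_mono order_trans[OF norm_ge_zero f\<^sub>0(2)])
  then have num: "((\<lambda>\<sigma>. num \<sigma> /\<^sub>R (\<sigma> * sqrt t) ^ CARD('n)) \<longlongrightarrow> L *\<^sub>R (f\<^sub>0 a *\<^sub>R u 0 a)) (at_right 0)"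
    unfolding num_def L_def
    by (intro gaussian_average_limit[OF t] continuous_intros f\<^sub>0 continuous_velocity time_zero)
  have den: "((\<lambda>\<sigma>. den \<sigma> /\<^sub>R (\<sigma> * sqrt t) ^ CARD('n)) \<longlongrightarrow> L *\<^sub>R f\<^sub>0 a) (at_right 0)"
    unfolding den_def L_def by (rule gaussian_average_limit[OF t f\<^sub>0(1,2)])
  have "((\<lambda>\<sigma>. (num \<sigma> /\<^sub>R (\<sigma> * sqrt t) ^ CARD('n)) /\<^sub>R (den \<sigma> /\<^sub>R (\<sigma> * sqrt t) ^ CARD('n)))
      \<longlongrightarrow> (L *\<^sub>R (f\<^sub>0 a *\<^sub>R u 0 a)) /\<^sub>R (L *\<^sub>R f\<^sub>0 a)) (at_right 0)"
    using L f\<^sub>0(3) by (intro tendsto_scaleR tendsto_inverse num den) simp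
  moreover have "inverse L * inverse (f\<^sub>0 a) * (L * f\<^sub>0 a) = 1"
    using L f\<^sub>0(3) by (simp add: field_simps)
  then have "(L *\<^sub>R (f\<^sub>0 a *\<^sub>R u 0 a)) /\<^sub>R (L *\<^sub>R f\<^sub>0 a) = u 0 a"
    by simp
  ultimately have lim: "((\<lambda>\<sigma>. (num \<sigma> /\<^sub>R (\<sigma> * sqrt t) ^ CARD('n)) /\<^sub>R (den \<sigma> /\<^sub>R (\<sigma> * sqrt t) ^ CARD('n)))
      \<longlongrightarrow> u 0 a) (at_right 0)"
    by metis
  have "(num \<sigma> /\<^sub>R (\<sigma> * sqrt t) ^ CARD('n)) /\<^sub>R (den \<sigma> /\<^sub>R (\<sigma> * sqrt t) ^ CARD('n))
      = uhat (u 0) f\<^sub>0 \<sigma> t ?x" if "\<sigma> > 0" for \<sigma>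
  proof -
    have "uhat (u 0) f\<^sub>0 \<sigma> t ?x = num \<sigma> /\<^sub>R den \<sigma>"
      using t(2) by (simp add: uhat_def num_def den_def mult_ac)
    then show ?thesis
      using that t(2) by simp
  qed
  then show ?thesis
    by (intro Lim_transform_eventually[OF lim]) (auto simp: eventually_at_filter)
qed

section \<open>The pressureless gas equations\<close>

lemma has_real_derivative_jacobian:
  assumes t: "t \<in> time_interval T"
  shows "((\<lambda>\<tau>. det (transport_gradient \<tau> s)) has_real_derivative
    trace (velocity_gradient t (transport_map (u 0) t s)) * det (transport_gradient t s)) (at t)"
  by (rule has_derivative_det_affine[OF velocity_gradient_transport[OF t]])

text \<open>
  For \<open>t > 0\<close> this is the limit of \<open>rho\<close>. The value at \<open>t = 0\<close> follows by continuity of \<open>f\<close> up to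
  the initial time, with the same constant on the right-hand side.
\<close>

lemma mass_conservation_along_trajectory:
  fixes f :: "real \<Rightarrow> real^'n \<Rightarrow> real"
  assumes t: "t \<in> time_interval T"
    and f\<^sub>0: "continuous_on UNIV f\<^sub>0" "\<And>s. norm (f\<^sub>0 s) \<le> M"
    and f: "continuous_on (Omega T) (\<lambda>(t, x). f t x)"
    and lim: "\<And>t x. t \<in> time_interval T \<Longrightarrow> ((\<lambda>\<sigma>. rho (u 0) f\<^sub>0 \<sigma> t x) \<longlongrightarrow> f t x) (at_right 0)"
  shows "f t (transport_map (u 0) t s) * \<bar>det (transport_gradient t s)\<bar>
    = (LINT z|lborel. exp (- ((norm (z :: real^'n))\<^sup>2 / 2))) / sqrt (2 * pi) ^ CARD('n) * f\<^sub>0 s"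
proof -
  define P where "P \<tau> = f \<tau> (transport_map (u 0) \<tau> s) * \<bar>det (transport_gradient \<tau> s)\<bar>" for \<tau>
  define m where "m = (LINT z|lborel. exp (- ((norm (z :: real^'n))\<^sup>2 / 2))) / sqrt (2 * pi) ^ CARD('n) * f\<^sub>0 s"
  have pos: "P \<tau> = m" if \<tau>: "\<tau> \<in> time_interval T" "\<tau> > 0" for \<tau>
  proof -
    have "f \<tau> (transport_map (u 0) \<tau> s) = (LINT z|lborel. exp (- ((norm (z :: real^'n))\<^sup>2 / 2)))
        / sqrt (2 * pi) ^ CARD('n) * (f\<^sub>0 s / \<bar>det (transport_gradient \<tau> s)\<bar>)"
      by (rule tendsto_unique[OF _ lim[OF \<tau>(1)] rho_limit[OF \<tau> f\<^sub>0]]) simp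
    then show ?thesis
      using det_transport_gradient_nonzero[OF \<tau>(1), of s] by (simp add: P_def m_def)
  qed
  have "P 0 = m"
  proof -
    have "continuous_on (time_interval T) (\<lambda>\<tau>. (\<lambda>(t, x). f t x) (\<tau>, transport_map (u 0) \<tau> s))"
      by (rule continuous_on_compose2[OF f])
        (auto simp: transport_map_def Omega_def intro!: continuous_intros)
    moreover have "continuous_on (time_interval T) (\<lambda>\<tau>. det (transport_gradient \<tau> s))"
      using has_real_derivative_jacobian
      by (meson DERIV_isCont continuous_at_imp_continuous_on)
    ultimately have "continuous_on (time_interval T) P"
      unfolding P_def by (auto intro!: continuous_intros)
    then have "(P \<longlongrightarrow> P 0) (at 0 within time_interval T)"
      using time_zero by (auto simp: continuous_on_def)
    moreover have "((\<lambda>\<tau>. m) \<longlongrightarrow> P 0) (at 0 within time_interval T)"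
      using calculation
      by (rule Lim_transform_eventually) (auto simp: eventually_at_filter time_interval_def intro!: always_eventually pos)
    ultimately show ?thesis
      using tendsto_unique[OF at_within_time_interval[OF time_zero] _ tendsto_const] by metis
  qed
  then have "P t = m"
    using pos t by (cases "t = 0") (auto simp: time_interval_def)
  then show ?thesis
    by (simp add: P_def m_def)
qed

text \<open>
  Squaring the conserved mass removes the absolute value of the Jacobian determinant and makes the
  quantity differentiable without a discussion of signs. Its derivative is
  \<open>2 F J\<^sup>2 (F' + F div u)\<close>, where the factor in front does not vanish because \<open>f\<^sub>0\<close> is positive.
\<close>

lemma continuity_equation:
  fixes f :: "real \<Rightarrow> real^'n \<Rightarrow> real"
  assumes t: "t \<in> time_interval T"
    and f\<^sub>0: "continuous_on UNIV f\<^sub>0" "\<And>s. norm (f\<^sub>0 s) \<le> M" "\<And>s. f\<^sub>0 s > 0"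
    and f: "\<And>t x. t \<in> time_interval T \<Longrightarrow> ((\<lambda>(t, x). f t x) has_derivative G (t, x)) (at (t, x) within Omega T)"
    and lim: "\<And>t x. t \<in> time_interval T \<Longrightarrow> ((\<lambda>\<sigma>. rho (u 0) f\<^sub>0 \<sigma> t x) \<longlongrightarrow> f t x) (at_right 0)"
  shows "G (t, x) (1, u t x) + f t x * trace (velocity_gradient t x) = 0"
proof -
  define s where "s = x - t *\<^sub>R u t x"
  have x: "transport_map (u 0) t s = x"
    unfolding s_def by (rule transport_map_inverse[OF t])
  have vel: "u 0 s = u t x"
    using velocity_at_transport_map[OF t, of s] by (simp add: x)
  define F where "F \<tau> = f \<tau> (transport_map (u 0) \<tau> s)" for \<tau>
  define J where "J \<tau> = det (transport_gradient \<tau> s)" for \<tau>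
  define m where "m = (LINT z|lborel. exp (- ((norm (z :: real^'n))\<^sup>2 / 2))) / sqrt (2 * pi) ^ CARD('n) * f\<^sub>0 s"
  have "continuous_on (Omega T) (\<lambda>(t, x). f t x)"
    by (rule has_derivative_continuous_on) (use f in \<open>auto simp: Omega_def\<close>)
  then have mass: "F \<tau> * \<bar>J \<tau>\<bar> = m" if "\<tau> \<in> time_interval T" for \<tau>
    unfolding F_def J_def m_def by (rule mass_conservation_along_trajectory[OF that f\<^sub>0(1,2) _ lim])
  have nonzero: "F t \<noteq> 0" "J t \<noteq> 0"
    using mass[OF t] gaussian_integral_pos[where 'a = "real^'n"] f\<^sub>0(3)[of s]
    by (auto simp: m_def)
  have F': "(F has_real_derivative G (t, x) (1, u t x)) (at t within time_interval T)"
  proof -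
    have "s + t *\<^sub>R u t x = x"
      by (simp add: s_def)
    then show ?thesis
      using derivative_along_line[of f "G (t, x)" t s "u t x"] f[OF t, of x] t
      unfolding F_def has_real_derivative_iff_has_vector_derivative
      by (simp add: transport_map_def vel)
  qed
  have J': "(J has_real_derivative trace (velocity_gradient t x) * J t) (at t within time_interval T)"
    using has_real_derivative_jacobian[OF t, of s] unfolding J_def x by (rule has_field_derivative_at_within)
  have "((\<lambda>\<tau>. (F \<tau>)\<^sup>2 * (J \<tau>)\<^sup>2) has_real_derivative
      2 * F t * (J t)\<^sup>2 * (G (t, x) (1, u t x) + F t * trace (velocity_gradient t x))) (at t within time_interval T)"
    by (auto intro!: derivative_eq_intros F' J' simp: power2_eq_square algebra_simps)
  moreover have "((\<lambda>\<tau>. (F \<tau>)\<^sup>2 * (J \<tau>)\<^sup>2) has_vector_derivative 0) (at t within time_interval T)"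
  proof (rule has_vector_derivative_transform[OF t])
    show "(F \<tau>)\<^sup>2 * (J \<tau>)\<^sup>2 = m\<^sup>2" if "\<tau> \<in> time_interval T" for \<tau>
      using arg_cong[OF mass[OF that], of power2] by (simp add: power_mult_distrib)
  qed simp
  ultimately have "2 * F t * (J t)\<^sup>2 * (G (t, x) (1, u t x) + F t * trace (velocity_gradient t x)) = 0"
    unfolding has_real_derivative_iff_has_vector_derivative
    using vector_derivative_unique_within[OF at_within_time_interval[OF t]] by blast
  then show ?thesis
    using nonzero by (simp add: F_def x)
qed

text \<open>
  The second equation is a consequence of the first: the product rule gives
  \<open>(f u\<^sub>i)\<^sub>t + div (f u\<^sub>i u) = u\<^sub>i (f\<^sub>t + div (f u)) + f (u\<^sub>i\<^sub>t + (u, \<nabla>u\<^sub>i))\<close>.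
\<close>

lemma solves_pressureless_gas_of_continuity_equation:
  fixes f :: "real \<Rightarrow> real^'n \<Rightarrow> real"
  assumes f: "\<And>t x. t \<in> time_interval T \<Longrightarrow> ((\<lambda>(t, x). f t x) has_derivative G (t, x)) (at (t, x) within Omega T)"
    and continuity: "\<And>t x. t \<in> time_interval T \<Longrightarrow> G (t, x) (1, u t x) + f t x * trace (velocity_gradient t x) = 0"
  shows "solves_pressureless_gas T f u"
proof -
  have "(\<exists>a d. has_time_deriv T (\<lambda>\<tau>. f \<tau> x) a t \<and> has_divergence (\<lambda>y. f t y *\<^sub>R u t y) d x \<and> a + d = 0) \<and>
      (\<forall>i. \<exists>a d. has_time_deriv T (\<lambda>\<tau>. f \<tau> x * u \<tau> x $ i) a t \<and>
        has_divergence (\<lambda>y. (f t y * u t y $ i) *\<^sub>R u t y) d x \<and> a + d = 0)"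
    if t: "t \<in> time_interval T" for t x
  proof (intro conjI allI)
    let ?g = "G (t, x)" and ?d = "blinfun_apply (D (t, x))"
    let ?div = "\<Sum>k\<in>UNIV. ?d (0, axis k 1) $ k"
    have div: "?div = trace (velocity_gradient t x)"
      by (simp add: trace_def velocity_gradient_def matrix_def)
    have split: "(1::real, u t x) = (1, 0) + (0, u t x)"
      by simp
    have g_split: "?g (1, u t x) = ?g (1, 0) + ?g (0, u t x)"
      unfolding split by (rule linear_add[OF has_derivative_linear[OF f[OF t]]])
    have d_split: "?d (1, 0) + ?d (0, u t x) = 0"
      using burgers[OF t, of x] unfolding split blinfun.add_right .
    have f_t: "((\<lambda>\<tau>. f \<tau> x) has_real_derivative ?g (1, 0)) (at t within time_interval T)"
      using derivative_along_line[of f ?g t x 0] f[OF t, of x] t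
      by (simp add: has_real_derivative_iff_has_vector_derivative)
    have "((\<lambda>\<tau>. u \<tau> x) has_vector_derivative ?d (1, 0)) (at t within time_interval T)"
      using derivative_along_line[of u ?d t x 0] deriv[OF t, of x] t by simp
    then have u_t: "((\<lambda>\<tau>. u \<tau> x $ i) has_real_derivative ?d (1, 0) $ i) (at t within time_interval T)" for i
      unfolding has_real_derivative_iff_has_vector_derivative
      by (rule bounded_linear.has_vector_derivative[OF bounded_linear_vec_nth])
    have f_x: "(f t has_derivative (\<lambda>w. ?g (0, w))) (at x)"
      by (rule spatial_derivative[OF f[OF t] t])
    have u_x: "(u t has_derivative (\<lambda>w. ?d (0, w))) (at x)"
      by (rule spatial_derivative[OF deriv[OF t] t])
    show "\<exists>a d. has_time_deriv T (\<lambda>\<tau>. f \<tau> x) a t \<and> has_divergence (\<lambda>y. f t y *\<^sub>R u t y) d x \<and> a + d = 0"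
    proof (intro exI conjI)
      show "has_time_deriv T (\<lambda>\<tau>. f \<tau> x) (?g (1, 0)) t"
        using f_t by (simp add: has_time_deriv_def has_real_derivative_iff_has_vector_derivative)
      show "has_divergence (\<lambda>y. f t y *\<^sub>R u t y) (?g (0, u t x) + f t x * ?div) x"
        by (rule has_divergence_scaleR[OF f_x u_x])
      show "?g (1, 0) + (?g (0, u t x) + f t x * ?div) = 0"
        using continuity[OF t, of x] by (simp add: div g_split)
    qed
    show "\<exists>a d. has_time_deriv T (\<lambda>\<tau>. f \<tau> x * u \<tau> x $ i) a t \<and>
        has_divergence (\<lambda>y. (f t y * u t y $ i) *\<^sub>R u t y) d x \<and> a + d = 0" for i
    proof (intro exI conjI)
      show "has_time_deriv T (\<lambda>\<tau>. f \<tau> x * u \<tau> x $ i) (?g (1, 0) * u t x $ i + ?d (1, 0) $ i * f t x) t"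
        using DERIV_mult[OF f_t u_t, of i]
        by (simp add: has_time_deriv_def has_real_derivative_iff_has_vector_derivative)
      have "((\<lambda>y. u t y $ i) has_derivative (\<lambda>w. ?d (0, w) $ i)) (at x)"
        by (rule bounded_linear.has_derivative[OF bounded_linear_vec_nth u_x])
      from has_divergence_scaleR[OF has_derivative_mult[OF f_x this] u_x]
      show "has_divergence (\<lambda>y. (f t y * u t y $ i) *\<^sub>R u t y)
        ((f t x * ?d (0, u t x) $ i + ?g (0, u t x) * u t x $ i) + (f t x * u t x $ i) * ?div) x" .
      have "?g (1, 0) * u t x $ i + ?d (1, 0) $ i * f t x
          + ((f t x * ?d (0, u t x) $ i + ?g (0, u t x) * u t x $ i) + (f t x * u t x $ i) * ?div)
        = (?g (1, u t x) + f t x * ?div) * u t x $ i + f t x * (?d (1, 0) + ?d (0, u t x)) $ i"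
        by (simp add: g_split algebra_simps)
      also have "\<dots> = 0"
        unfolding d_split div by (simp add: continuity[OF t])
      finally show "?g (1, 0) * u t x $ i + ?d (1, 0) $ i * f t x
          + ((f t x * ?d (0, u t x) $ i + ?g (0, u t x) * u t x $ i) + (f t x * u t x $ i) * ?div) = 0" .
    qed
  qed
  then show ?thesis
    by (auto simp: solves_pressureless_gas_def Omega_def)
qed

end

lemma solves_pressureless_gas_cong:
  fixes v w :: "real \<Rightarrow> real^'n \<Rightarrow> real^'n"
  assumes "solves_pressureless_gas T f v"
    and eq: "\<And>t x. t \<in> time_interval T \<Longrightarrow> w t x = v t x"
  shows "solves_pressureless_gas T f w"
proof -
  have time: "has_time_deriv T (\<lambda>\<tau>. f \<tau> x * w \<tau> x $ i) a t"
    if "t \<in> time_interval T" "has_time_deriv T (\<lambda>\<tau>. f \<tau> x * v \<tau> x $ i) a t" for t i a and x :: "real^'n"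
    using that(2) unfolding has_time_deriv_def
    by (rule has_vector_derivative_transform[OF that(1), rotated]) (simp add: eq)
  have space: "w t = v t" if "t \<in> time_interval T" for t
    using eq[OF that] by auto
  show ?thesis
    unfolding solves_pressureless_gas_def
  proof (clarify, intro conjI allI)
    fix t i and x :: "real^'n"
    assume "(t, x) \<in> Omega T"
    then have t: "t \<in> time_interval T"
      by (simp add: Omega_def)
    have *: "(\<exists>a d. has_time_deriv T (\<lambda>\<tau>. f \<tau> x) a t \<and> has_divergence (\<lambda>y. f t y *\<^sub>R v t y) d x \<and> a + d = 0)"
      "(\<exists>a d. has_time_deriv T (\<lambda>\<tau>. f \<tau> x * v \<tau> x $ i) a t \<and>
        has_divergence (\<lambda>y. (f t y * v t y $ i) *\<^sub>R v t y) d x \<and> a + d = 0)"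
      using assms(1) \<open>(t, x) \<in> Omega T\<close> unfolding solves_pressureless_gas_def by auto
    show "\<exists>a d. has_time_deriv T (\<lambda>\<tau>. f \<tau> x) a t \<and> has_divergence (\<lambda>y. f t y *\<^sub>R w t y) d x \<and> a + d = 0"
      using *(1) by (simp add: space[OF t])
    show "\<exists>a d. has_time_deriv T (\<lambda>\<tau>. f \<tau> x * w \<tau> x $ i) a t \<and>
        has_divergence (\<lambda>y. (f t y * w t y $ i) *\<^sub>R w t y) d x \<and> a + d = 0"
      using *(2) time[OF t] unfolding space[OF t] by blast
  qed
qed

text \<open>
  The partial derivatives in the definition of a smooth solution are those of the total derivative,
  and the equation in terms of partial derivatives is the expansion of \<open>D(1, u) = 0\<close>.
\<close>

lemma burgers_flow_of_smooth_Cauchy_solution: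
  assumes "0 < T" and "smooth_Cauchy_solution u\<^sub>0 T u"
  obtains D where "burgers_flow T u D"
proof -
  obtain D where D: "\<forall>p\<in>Omega T. ((\<lambda>(t, x). u t x) has_derivative blinfun_apply (D p)) (at p within Omega T)"
    and cont: "continuous_on (Omega T) D"
    using assms(2) unfolding smooth_Cauchy_solution_def C1_on_def by blast
  have deriv: "((\<lambda>(t, x). u t x) has_derivative blinfun_apply (D (t, x))) (at (t, x) within Omega T)"
    if "t \<in> time_interval T" for t x
    using D that by (auto simp: Omega_def)
  have "blinfun_apply (D (t, x)) (1, u t x) = 0" if t: "t \<in> time_interval T" for t x
  proof -
    let ?d = "blinfun_apply (D (t, x))"
    obtain ut E where ut: "has_time_deriv T (\<lambda>\<tau>. u \<tau> x) ut t"
      and E: "\<And>k. has_partial_deriv (u t) k (E k) x"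
      and eq: "ut + (\<Sum>k\<in>UNIV. (u t x $ k) *\<^sub>R E k) = 0"
      using assms(2) t unfolding smooth_Cauchy_solution_def Omega_def by fast
    have u_x: "(u t has_derivative (\<lambda>w. ?d (0, w))) (at x)"
      by (rule spatial_derivative[OF deriv[OF t] t])
    have "ut = ?d (1, 0)"
      using ut derivative_along_line[of u ?d t x 0] deriv[OF t, of x] t
        vector_derivative_unique_within[OF at_within_time_interval[OF t]]
      by (auto simp: has_time_deriv_def)
    moreover have "E k = ?d (0, axis k 1)" for k
      using E[of k] has_partial_deriv_of_has_derivative[OF u_x, of k]
      unfolding has_partial_deriv_def by (rule vector_derivative_unique_at)
    ultimately have "?d (1, 0) + ?d (0, u t x) = 0"
      using eq linear_axis_expansion[OF has_derivative_linear[OF u_x], of "u t x"] by simp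
    then show ?thesis
      by (simp flip: blinfun.add_right)
  qed
  moreover have "bounded (range (u t))" if "t \<in> time_interval T" for t
    using assms(2) that by (auto simp: smooth_Cauchy_solution_def C1_bounded_on_def)
  ultimately have "burgers_flow T u D"
    using assms(1) deriv cont by unfold_locales
  then show ?thesis
    by (rule that)
qed

theorem proposition3:
  fixes u\<^sub>0 :: "real ^ 'n \<Rightarrow> real ^ 'n"
    and f\<^sub>0 :: "real ^ 'n \<Rightarrow> real"
    and T :: ereal
    and f :: "real \<Rightarrow> real ^ 'n \<Rightarrow> real"
    and ubar :: "real \<Rightarrow> real ^ 'n \<Rightarrow> real ^ 'n"
  assumes "C1_bounded_on UNIV u\<^sub>0"
    and "C1_bounded_on UNIV f\<^sub>0"
    and "\<forall>x. f\<^sub>0 x > 0"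
    and "smooth_lifespan u\<^sub>0 T"
    and "\<forall>(t, x)\<in>Omega T. ((\<lambda>\<sigma>. rho u\<^sub>0 f\<^sub>0 \<sigma> t x) \<longlongrightarrow> f t x) (at_right 0)"
    and "\<forall>(t, x)\<in>Omega T. ((\<lambda>\<sigma>. uhat u\<^sub>0 f\<^sub>0 \<sigma> t x) \<longlongrightarrow> ubar t x) (at_right 0)"
    and "C1_bounded_on (Omega T) (\<lambda>(t, x). f t x)"
    and "C1_bounded_on (Omega T) (\<lambda>(t, x). ubar t x)"
  shows "solves_pressureless_gas T f ubar"
proof -
  obtain u where "0 < T" and u: "smooth_Cauchy_solution u\<^sub>0 T u"
    using assms(4) by (auto simp: smooth_lifespan_def)
  then obtain D where "burgers_flow T u D"
    using burgers_flow_of_smooth_Cauchy_solution by blast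
  then interpret burgers_flow T u D .
  have u0: "u\<^sub>0 = u 0"
    using u by (auto simp: smooth_Cauchy_solution_def)
  obtain D\<^sub>0 where "\<And>x. (f\<^sub>0 has_derivative blinfun_apply (D\<^sub>0 x)) (at x)"
    using assms(2) by (auto simp: C1_bounded_on_def C1_on_def)
  then have f0_cont: "continuous_on UNIV f\<^sub>0"
    by (meson has_derivative_at_withinI has_derivative_continuous_on)
  obtain M where M: "\<And>s. norm (f\<^sub>0 s) \<le> M"
    using assms(2) unfolding C1_bounded_on_def bounded_iff by blast
  obtain G where f: "((\<lambda>(t, x). f t x) has_derivative blinfun_apply (G (t, x))) (at (t, x) within Omega T)"
    if "t \<in> time_interval T" for t x
    using assms(7) by (auto simp: C1_bounded_on_def C1_on_def Omega_def)
  have f_lim: "((\<lambda>\<sigma>. rho (u 0) f\<^sub>0 \<sigma> t x) \<longlongrightarrow> f t x) (at_right 0)" if "t \<in> time_interval T" for t x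
    using assms(5) that by (auto simp: Omega_def u0)
  have ubar: "ubar t x = u t x" if t: "t \<in> time_interval T" for t x
  proof -
    have lim: "((\<lambda>\<sigma>. uhat (u 0) f\<^sub>0 \<sigma> t x) \<longlongrightarrow> ubar t x) (at_right 0)"
      using assms(6) t by (auto simp: Omega_def u0)
    have "((\<lambda>\<sigma>. uhat (u 0) f\<^sub>0 \<sigma> t x) \<longlongrightarrow> u t x) (at_right 0)"
    proof (cases "t = 0")
      case True
      then show ?thesis
        by (simp add: uhat_def)
    next
      case False
      define s where "s = x - t *\<^sub>R u t x"
      have x: "transport_map (u 0) t s = x"
        unfolding s_def by (rule transport_map_inverse[OF t])
      have "t > 0"
        using t False by (simp add: time_interval_def)
      moreover have "f\<^sub>0 s \<noteq> 0"
        using assms(3) less_irrefl by metis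
      ultimately show ?thesis
        using uhat_limit[OF t _ f0_cont M, of s] velocity_at_transport_map[OF t, of s] by (simp add: x)
    qed
    with lim show ?thesis
      using tendsto_unique trivial_limit_at_right_real by blast
  qed
  have continuity: "blinfun_apply (G (t, x)) (1, u t x) + f t x * trace (velocity_gradient t x) = 0"
    if "t \<in> time_interval T" for t x
    using continuity_equation[OF that f0_cont M _ f f_lim, of x] assms(3) by simp
  have "solves_pressureless_gas T f u"
    by (rule solves_pressureless_gas_of_continuity_equation[where G = "\<lambda>p. blinfun_apply (G p)"])
      (fact f continuity)+
  then show ?thesis
    by (rule solves_pressureless_gas_cong) (rule ubar)
qed

end
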